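(* Let $q$ be a map assigning to each Riemannian metric on a manifold $M$ a symmetric $2$-tensor field on $M$, and let $g(t)$ be a solution to the $q$-flow, $\frac{\partial g}{\partial t}=q(g(t))$. Suppose $g(t)$ is fixed up to conformal diffeomorphism. Then $g(t)$ is an extended $q(g(t))$-soliton, i.e. for each $t$ there are a vector field $X$ and a function $\varphi$ on $M$ (depending on $t$) with $$\tfrac12\mathcal{L}_Xg(t)=\tfrac12q(g(t))+\varphi\,g(t).$$
   Context: $g(t)$ is a smooth one-parameter family of Riemannian metrics on $M$. It is fixed up to conformal diffeomorphism if $$g(t)=v_tF_t^*(g(0))$$ for some positive functions $v_t:M\to\mathbb{R}$ and a one-parameter family of diffeomorphisms $F_t:M\to M$ with $v_0=1$, $F_0=\mathrm{id}$, both assumed differentiable (jointly in $t$ and the point of $M$). $\mathcal{L}$ denotes the Lie derivative. *)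

theory Defs
  imports "HOL-Analysis.Analysis"
begin

section \<open>Functions of class \<open>C\<^sup>k\<close>\<close>

text \<open>Derivatives are taken within \<open>S\<close>, so that \<open>S\<close> may be the product of an interval
  (possibly with end points) and an open set; there the derivatives at the boundary are one-sided.
  On such sets, and on their relatively open subsets, derivatives are unique if the interval is
  nondegenerate.\<close>

primrec Ck_on :: "nat \<Rightarrow> 'a::euclidean_space set \<Rightarrow> ('a \<Rightarrow> 'b::real_normed_vector) \<Rightarrow> bool" where
  "Ck_on 0 S f \<longleftrightarrow> continuous_on S f"
| "Ck_on (Suc k) S f \<longleftrightarrow>
     (\<exists>f'. (\<forall>x\<in>S. (f has_derivative f' x) (at x within S)) \<and> (\<forall>u. Ck_on k S (\<lambda>x. f' x u)))"

text \<open>The case \<open>r = \<infinity>\<close> is smoothness.\<close>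

definition C_on :: "enat \<Rightarrow> 'a::euclidean_space set \<Rightarrow> ('a \<Rightarrow> 'b::real_normed_vector) \<Rightarrow> bool" where
  "C_on r S f \<longleftrightarrow> (\<forall>k. enat k \<le> r \<longrightarrow> Ck_on k S f)"


section \<open>Smooth manifolds\<close>

text \<open>A chart is an open set together with a map whose restriction to that set is a homeomorphism
  onto an open subset of the model space; values of the map elsewhere are irrelevant.\<close>

type_synonym ('m, 'e) chart = "'m set \<times> ('m \<Rightarrow> 'e)"

abbreviation chart_dom :: "('m, 'e) chart \<Rightarrow> 'm set" where
  "chart_dom c \<equiv> fst c"

abbreviation chart_map :: "('m, 'e) chart \<Rightarrow> 'm \<Rightarrow> 'e" where
  "chart_map c \<equiv> snd c"

definition chart_cod :: "('m, 'e) chart \<Rightarrow> 'e set" where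
  "chart_cod c = chart_map c ` chart_dom c"

definition chart_inv :: "('m, 'e) chart \<Rightarrow> 'e \<Rightarrow> 'm" where
  "chart_inv c = inv_into (chart_dom c) (chart_map c)"

definition transition :: "('m, 'e) chart \<Rightarrow> ('m, 'e) chart \<Rightarrow> 'e \<Rightarrow> 'e" where
  "transition c d = chart_map d \<circ> chart_inv c"

definition smooth_atlas :: "('m::topological_space, 'e::euclidean_space) chart set \<Rightarrow> bool" where
  "smooth_atlas A \<longleftrightarrow>
     (\<forall>c\<in>A. open (chart_dom c) \<and> open (chart_cod c) \<and>
        homeomorphism (chart_dom c) (chart_cod c) (chart_map c) (chart_inv c)) \<and>
     (\<Union>c\<in>A. chart_dom c) = UNIV \<and>
     (\<forall>c\<in>A. \<forall>d\<in>A. C_on \<infinity> (chart_map c ` (chart_dom c \<inter> chart_dom d)) (transition c d))"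

definition charts_at :: "('m, 'e) chart set \<Rightarrow> 'm \<Rightarrow> ('m, 'e) chart set" where
  "charts_at A p = {c \<in> A. p \<in> chart_dom c}"

text \<open>Some chart of \<open>A\<close> at \<open>p\<close>; it is used only where the result does not depend on the choice.\<close>

definition chart_at :: "('m, 'e) chart set \<Rightarrow> 'm \<Rightarrow> ('m, 'e) chart" where
  "chart_at A p = (SOME c. c \<in> charts_at A p)"


section \<open>Functions and maps on a manifold\<close>

definition C_function :: "('m, 'e::euclidean_space) chart set \<Rightarrow> enat \<Rightarrow> ('m \<Rightarrow> real) \<Rightarrow> bool" where
  "C_function A r f \<longleftrightarrow> (\<forall>c\<in>A. C_on r (chart_cod c) (f \<circ> chart_inv c))"

definition differentiable_function_family ::
    "('m, 'e::euclidean_space) chart set \<Rightarrow> real set \<Rightarrow> (real \<Rightarrow> 'm \<Rightarrow> real) \<Rightarrow> bool" where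
  "differentiable_function_family A I v \<longleftrightarrow>
     (\<forall>c\<in>A. (\<lambda>(t, x). v t (chart_inv c x)) differentiable_on (I \<times> chart_cod c))"

definition map_in_charts ::
    "('m, 'e) chart \<Rightarrow> ('m, 'e) chart \<Rightarrow> ('m \<Rightarrow> 'm) \<Rightarrow> 'e \<Rightarrow> 'e" where
  "map_in_charts c d f = chart_map d \<circ> f \<circ> chart_inv c"

definition C_map ::
    "('m::topological_space, 'e::euclidean_space) chart set \<Rightarrow> enat \<Rightarrow> ('m \<Rightarrow> 'm) \<Rightarrow> bool" where
  "C_map A r f \<longleftrightarrow> continuous_on UNIV f \<and>
     (\<forall>c\<in>A. \<forall>d\<in>A.
        C_on r {x \<in> chart_cod c. f (chart_inv c x) \<in> chart_dom d} (map_in_charts c d f))"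

definition C_diffeomorphism ::
    "('m::topological_space, 'e::euclidean_space) chart set \<Rightarrow> enat \<Rightarrow> ('m \<Rightarrow> 'm) \<Rightarrow> bool" where
  "C_diffeomorphism A r f \<longleftrightarrow> bij f \<and> C_map A r f \<and> C_map A r (inv f)"

text \<open>Regularity is joint in the parameter and the point of the manifold.\<close>

definition C_map_family ::
    "('m::topological_space, 'e::euclidean_space) chart set \<Rightarrow> enat \<Rightarrow> real set \<Rightarrow>
     (real \<Rightarrow> 'm \<Rightarrow> 'm) \<Rightarrow> bool" where
  "C_map_family A r I F \<longleftrightarrow> continuous_on (I \<times> UNIV) (\<lambda>(t, p). F t p) \<and>
     (\<forall>c\<in>A. \<forall>d\<in>A.
        C_on r {(t, x). t \<in> I \<and> x \<in> chart_cod c \<and> F t (chart_inv c x) \<in> chart_dom d}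
          (\<lambda>(t, x). map_in_charts c d (F t) x))"


section \<open>Tangent vectors and vector fields\<close>

text \<open>A tangent vector at \<open>p\<close> is the family of its coordinate vectors in all charts at \<open>p\<close>,
  subject to the contravariant transformation law; it is \<open>0\<close> on all other arguments, so that
  equality of tangent vectors is equality in \<^term>\<open>tangent_space A p\<close>.\<close>

type_synonym ('m, 'e) tvec = "('m, 'e) chart \<Rightarrow> 'e"

definition tangent_space :: "('m, 'e::euclidean_space) chart set \<Rightarrow> 'm \<Rightarrow> ('m, 'e) tvec set" where
  "tangent_space A p =
     {v. (\<forall>c\<in>charts_at A p. \<forall>d\<in>charts_at A p.
            v d = frechet_derivative (transition c d) (at (chart_map c p)) (v c)) \<and>
         (\<forall>c. c \<notin> charts_at A p \<longrightarrow> v c = 0)}"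

text \<open>The tangent vector at \<open>p\<close> with coordinates \<open>u\<close> in the chart \<open>c\<close>.\<close>

definition chart_vector ::
    "('m, 'e::euclidean_space) chart set \<Rightarrow> ('m, 'e) chart \<Rightarrow> 'm \<Rightarrow> 'e \<Rightarrow> ('m, 'e) tvec" where
  "chart_vector A c p u =
     (\<lambda>d. if d \<in> charts_at A p
          then frechet_derivative (transition c d) (at (chart_map c p)) u else 0)"

definition differential ::
    "('m, 'e::euclidean_space) chart set \<Rightarrow> ('m \<Rightarrow> 'm) \<Rightarrow> 'm \<Rightarrow> ('m, 'e) tvec \<Rightarrow> ('m, 'e) tvec" where
  "differential A f p v =
     (let c = chart_at A p in
      (\<lambda>d. if d \<in> charts_at A (f p)
           then frechet_derivative (map_in_charts c d f) (at (chart_map c p)) (v c) else 0))"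

type_synonym ('m, 'e) vfield = "'m \<Rightarrow> ('m, 'e) tvec"

definition field_in_chart :: "('m, 'e) chart \<Rightarrow> ('m, 'e) vfield \<Rightarrow> 'e \<Rightarrow> 'e" where
  "field_in_chart c X x = X (chart_inv c x) c"

definition C_vector_field ::
    "('m, 'e::euclidean_space) chart set \<Rightarrow> enat \<Rightarrow> ('m, 'e) vfield \<Rightarrow> bool" where
  "C_vector_field A r X \<longleftrightarrow> (\<forall>p. X p \<in> tangent_space A p) \<and>
     (\<forall>c\<in>A. C_on r (chart_cod c) (field_in_chart c X))"


section \<open>Symmetric 2-tensor fields and Riemannian metrics\<close>

type_synonym ('m, 'e) tensor2 = "'m \<Rightarrow> ('m, 'e) tvec \<Rightarrow> ('m, 'e) tvec \<Rightarrow> real"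

definition tensor_in_chart ::
    "('m, 'e::euclidean_space) chart set \<Rightarrow> ('m, 'e) chart \<Rightarrow> ('m, 'e) tensor2 \<Rightarrow>
     'e \<Rightarrow> 'e \<Rightarrow> 'e \<Rightarrow> real" where
  "tensor_in_chart A c h x u w =
     (let p = chart_inv c x in h p (chart_vector A c p u) (chart_vector A c p w))"

text \<open>As the last argument of \<^term>\<open>h p\<close> may be any function on charts, a tensor is required to vanish
  off the tangent spaces; this makes the representation of a tensor field unique.\<close>

definition symmetric_tensor_field ::
    "('m, 'e::euclidean_space) chart set \<Rightarrow> ('m, 'e) tensor2 \<Rightarrow> bool" where
  "symmetric_tensor_field A h \<longleftrightarrow>
     (\<forall>p v w. v \<notin> tangent_space A p \<or> w \<notin> tangent_space A p \<longrightarrow> h p v w = 0) \<and>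
     (\<forall>p. \<forall>v\<in>tangent_space A p. \<forall>w\<in>tangent_space A p. h p v w = h p w v) \<and>
     (\<forall>c\<in>A. (\<forall>x\<in>chart_cod c. bilinear (tensor_in_chart A c h x)) \<and>
        (\<forall>u w. C_on \<infinity> (chart_cod c) (\<lambda>x. tensor_in_chart A c h x u w)))"

definition riemannian_metric ::
    "('m, 'e::euclidean_space) chart set \<Rightarrow> ('m, 'e) tensor2 \<Rightarrow> bool" where
  "riemannian_metric A h \<longleftrightarrow> symmetric_tensor_field A h \<and>
     (\<forall>p. \<forall>v\<in>tangent_space A p. v \<noteq> (\<lambda>_. 0) \<longrightarrow> h p v v > 0)"

definition pullback ::
    "('m, 'e::euclidean_space) chart set \<Rightarrow> ('m \<Rightarrow> 'm) \<Rightarrow> ('m, 'e) tensor2 \<Rightarrow> ('m, 'e) tensor2" where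
  "pullback A f h p v w = h (f p) (differential A f p v) (differential A f p w)"

text \<open>In coordinates, \<open>(L\<^sub>X h)\<^sub>i\<^sub>j = X\<^sup>k \<partial>\<^sub>k h\<^sub>i\<^sub>j + h\<^sub>k\<^sub>j \<partial>\<^sub>i X\<^sup>k + h\<^sub>i\<^sub>k \<partial>\<^sub>j X\<^sup>k\<close>. This is the Leibniz rule
  \<open>(L\<^sub>X h)(Y, Z) = X (h (Y, Z)) - h ([X, Y], Z) - h (Y, [X, Z])\<close> for \<open>Y\<close>, \<open>Z\<close> with constant
  coefficients in the chart.\<close>

definition lie_derivative ::
    "('m, 'e::euclidean_space) chart set \<Rightarrow> ('m, 'e) vfield \<Rightarrow> ('m, 'e) tensor2 \<Rightarrow>
     ('m, 'e) tensor2" where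
  "lie_derivative A X h p v w =
     (let c = chart_at A p;
          x = chart_map c p;
          hc = tensor_in_chart A c h;
          Xc = field_in_chart c X;
          DX = frechet_derivative Xc (at x)
      in frechet_derivative (\<lambda>y. hc y (v c) (w c)) (at x) (Xc x)
         + hc x (DX (v c)) (w c) + hc x (v c) (DX (w c)))"


section \<open>Geometric flows and solitons\<close>

definition smooth_metric_family ::
    "('m, 'e::euclidean_space) chart set \<Rightarrow> real set \<Rightarrow> (real \<Rightarrow> ('m, 'e) tensor2) \<Rightarrow> bool" where
  "smooth_metric_family A I g \<longleftrightarrow> (\<forall>t\<in>I. riemannian_metric A (g t)) \<and>
     (\<forall>c\<in>A. \<forall>u w. C_on \<infinity> (I \<times> chart_cod c) (\<lambda>(t, x). tensor_in_chart A c (g t) x u w))"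

definition solves_flow ::
    "('m, 'e::euclidean_space) chart set \<Rightarrow> (('m, 'e) tensor2 \<Rightarrow> ('m, 'e) tensor2) \<Rightarrow> real set \<Rightarrow>
     (real \<Rightarrow> ('m, 'e) tensor2) \<Rightarrow> bool" where
  "solves_flow A q I g \<longleftrightarrow>
     (\<forall>t\<in>I. \<forall>p. \<forall>v\<in>tangent_space A p. \<forall>w\<in>tangent_space A p.
        ((\<lambda>s. g s p v w) has_real_derivative q (g t) p v w) (at t within I))"

text \<open>The diffeomorphisms are jointly of class \<open>C\<^sup>r\<close>. Nothing beyond joint differentiability is asked
  of the conformal factor \<open>v\<close>.\<close>

definition fixed_up_to_conformal_diffeomorphism ::
    "('m::topological_space, 'e::euclidean_space) chart set \<Rightarrow> enat \<Rightarrow> real set \<Rightarrow>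
     (real \<Rightarrow> ('m, 'e) tensor2) \<Rightarrow> bool" where
  "fixed_up_to_conformal_diffeomorphism A r I g \<longleftrightarrow>
     (\<exists>v F. (\<forall>t\<in>I. \<forall>p. v t p > 0) \<and> (\<forall>p. v 0 p = 1) \<and> differentiable_function_family A I v \<and>
        (\<forall>t\<in>I. C_diffeomorphism A r (F t)) \<and> F 0 = id \<and> C_map_family A r I F \<and>
        (\<forall>t\<in>I. \<forall>p. \<forall>a\<in>tangent_space A p. \<forall>b\<in>tangent_space A p.
           g t p a b = v t p * pullback A (F t) (g 0) p a b))"

text \<open>The Lie derivative makes sense for fields of class \<open>C\<^sup>1\<close> at least; it costs one derivative.\<close>

definition extended_soliton ::
    "('m, 'e::euclidean_space) chart set \<Rightarrow> enat \<Rightarrow> ('m, 'e) tensor2 \<Rightarrow> ('m, 'e) tensor2 \<Rightarrow> bool" where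
  "extended_soliton A r Q h \<longleftrightarrow>
     (\<exists>X \<phi>. C_vector_field A (r + 1) X \<and> C_function A r \<phi> \<and>
        (\<forall>p. \<forall>v\<in>tangent_space A p. \<forall>w\<in>tangent_space A p.
           1 / 2 * lie_derivative A X h p v w = 1 / 2 * Q p v w + \<phi> p * h p v w))"

end

theory Submission
  imports Defs
begin

text \<open>
  Let \<open>g\<^sub>t = v\<^sub>t F\<^sub>t\<^sup>* g\<^sub>0\<close>, and let \<open>X\<close> be the velocity of \<open>F\<close> at time \<open>t\<close>, pulled back to the manifold by
  the inverse of the differential of \<open>F\<^sub>t\<close>. Then \<open>\<partial>\<^sub>t (F\<^sub>t\<^sup>* g\<^sub>0) = L\<^sub>X (F\<^sub>t\<^sup>* g\<^sub>0)\<close>, and since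
  \<open>F\<^sub>t\<^sup>* g\<^sub>0 = g\<^sub>t / v\<^sub>t\<close>, the product rules for \<open>\<partial>\<^sub>t\<close> and \<open>L\<^sub>X\<close> give
  \<open>q (g\<^sub>t) = \<partial>\<^sub>t g\<^sub>t = L\<^sub>X g\<^sub>t + ((\<partial>\<^sub>t v - X v) / v) g\<^sub>t\<close>. This is the soliton equation with
  \<open>\<phi> = (X v - \<partial>\<^sub>t v) / (2 v)\<close>.

  The formula for \<open>\<partial>\<^sub>t (F\<^sub>t\<^sup>* g\<^sub>0)\<close> is proved in coordinates, without flows of vector fields. In
  charts, \<open>F\<close> is a map \<open>f\<close> of \<open>(s, y)\<close> whose derivative at time \<open>t\<close> annihilates \<open>(1, - X y)\<close> for all
  \<open>y\<close>. Differentiating the pulled-back form in the direction \<open>(1, - X)\<close>, the coefficients of \<open>g\<^sub>0\<close>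
  along \<open>f\<close> do not change, while the vectors \<open>\<partial>\<^sub>u f\<close> change by \<open>\<partial>\<^bsub>DX u\<^esub> f\<close>, by the symmetry of the
  second derivatives of \<open>f\<close> (\<open>spatial_derivative_along_transport\<close>). This leaves exactly the
  terms of the Lie derivative (\<open>conformal_pullback_time_derivative\<close>). As \<open>t\<close> may be an end point of
  the interval, the symmetry is needed at a boundary point of the domain of \<open>f\<close>; it follows from a
  mean value argument on squares that have the point as a corner
  (\<open>symmetric_second_derivative\<close>).

  The identity holds in every chart (\<open>lie_derivative_of_conformal_pullback_family\<close>), and the
  factor \<open>\<phi>\<close> is the same in all of them (\<open>material_derivative_chart_independent\<close>). For the
  regularity of \<open>X\<close>, the inverse of the differential of \<open>F\<^sub>t\<close> is the differential of \<open>F\<^sub>t\<^sup>-\<^sup>1\<close>, so that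
  \<open>X\<close> is one derivative worse than \<open>F\<close> (\<open>Ck_on_pulled_back_velocity\<close>). The formula for \<open>\<phi>\<close> gives
  no regularity, since \<open>v\<close> is merely differentiable; but \<open>g\<^sub>t\<close> is positive definite, so the soliton
  equation itself can be solved for \<open>\<phi>\<close>, which is therefore as regular as \<open>L\<^sub>X g\<^sub>t\<close>.
\<close>

section \<open>Calculus of functions of class \<open>C\<^sup>k\<close>\<close>

lemma Ck_on_cong: "(\<And>x. x \<in> S \<Longrightarrow> f x = g x) \<Longrightarrow> Ck_on k S f \<longleftrightarrow> Ck_on k S g"
proof (cases k)
  case 0
  assume "\<And>x. x \<in> S \<Longrightarrow> f x = g x"
  then show ?thesis using 0 by (simp cong: continuous_on_cong)
next
  case (Suc n)
  assume fg: "\<And>x. x \<in> S \<Longrightarrow> f x = g x"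
  then have "(f has_derivative f') (at x within S) \<longleftrightarrow> (g has_derivative f') (at x within S)"
    if "x \<in> S" for x f'
    using that by (metis has_derivative_transform)
  then show ?thesis using Suc by simp
qed

lemma Ck_on_Suc_imp: "Ck_on (Suc k) S f \<Longrightarrow> Ck_on k S f"
proof (induction k arbitrary: f)
  case 0
  then show ?case by (auto simp: continuous_on_eq_continuous_within intro: has_derivative_continuous)
next
  case (Suc k)
  then show ?case by (metis Ck_on.simps(2))
qed

lemma Ck_on_const: "Ck_on k S (\<lambda>x. c)"
proof (induction k arbitrary: c)
  case (Suc k)
  then show ?case by (simp, intro exI[of _ "\<lambda>_ _. 0"]) simp
qed simp

lemma Ck_on_bounded_linear:
  assumes "bounded_linear L"
  shows "Ck_on k S L"
proof (cases k)
  case 0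
  then show ?thesis using assms by (simp add: linear_continuous_on)
next
  case (Suc n)
  then show ?thesis using assms
    by (simp, intro exI[of _ "\<lambda>_. L"]) (simp add: Ck_on_const bounded_linear_imp_has_derivative)
qed

lemma Ck_on_add:
  "Ck_on k S f \<Longrightarrow> Ck_on k S g \<Longrightarrow> Ck_on k S (\<lambda>x. f x + g x)"
proof (induction k arbitrary: f g)
  case 0
  then show ?case by (auto intro: continuous_intros)
next
  case (Suc k)
  obtain f' where
    "\<forall>x\<in>S. (f has_derivative f' x) (at x within S)" "\<forall>u. Ck_on k S (\<lambda>x. f' x u)"
    using Suc.prems(1)[unfolded Ck_on.simps] by blast
  moreover obtain g' where
    "\<forall>x\<in>S. (g has_derivative g' x) (at x within S)" "\<forall>u. Ck_on k S (\<lambda>x. g' x u)"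
    using Suc.prems(2)[unfolded Ck_on.simps] by blast
  ultimately show ?case
    by (simp, intro exI[of _ "\<lambda>x u. f' x u + g' x u"]) (auto intro!: has_derivative_add Suc.IH)
qed

lemma Ck_on_sum:
  "(\<And>i. i \<in> J \<Longrightarrow> Ck_on k S (f i)) \<Longrightarrow> Ck_on k S (\<lambda>x. \<Sum>i\<in>J. f i x)"
  by (induction J rule: infinite_finite_induct) (auto intro: Ck_on_const Ck_on_add)

lemma Ck_on_scaleR:
  fixes a :: "'a::euclidean_space \<Rightarrow> real" and f :: "'a \<Rightarrow> 'b::real_normed_vector"
  shows "Ck_on k S a \<Longrightarrow> Ck_on k S f \<Longrightarrow> Ck_on k S (\<lambda>x. a x *\<^sub>R f x)"
proof (induction k arbitrary: a f)
  case 0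
  then show ?case by (auto intro: continuous_intros)
next
  case (Suc k)
  obtain a' where a':
    "\<forall>x\<in>S. (a has_derivative a' x) (at x within S)" "\<forall>u. Ck_on k S (\<lambda>x. a' x u)"
    using Suc.prems(1)[unfolded Ck_on.simps] by blast
  obtain f' where f':
    "\<forall>x\<in>S. (f has_derivative f' x) (at x within S)" "\<forall>u. Ck_on k S (\<lambda>x. f' x u)"
    using Suc.prems(2)[unfolded Ck_on.simps] by blast
  have "Ck_on k S a" "Ck_on k S f"
    using Suc.prems by (auto intro: Ck_on_Suc_imp simp del: Ck_on.simps)
  with a' f' show ?case
    by (simp, intro exI[of _ "\<lambda>x u. a x *\<^sub>R f' x u + a' x u *\<^sub>R f x"])
      (auto intro!: has_derivative_scaleR Suc.IH Ck_on_add)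
qed

lemma Ck_on_mult:
  fixes f g :: "'a::euclidean_space \<Rightarrow> real"
  shows "Ck_on k S f \<Longrightarrow> Ck_on k S g \<Longrightarrow> Ck_on k S (\<lambda>x. f x * g x)"
  using Ck_on_scaleR[of k S f g] by simp

lemma Ck_on_diff:
  fixes f g :: "'a::euclidean_space \<Rightarrow> real"
  shows "Ck_on k S f \<Longrightarrow> Ck_on k S g \<Longrightarrow> Ck_on k S (\<lambda>x. f x - g x)"
  using Ck_on_add[OF _ Ck_on_mult[OF Ck_on_const[of k S "-1"]], of f g] by simp

lemma Ck_on_inverse:
  fixes f :: "'a::euclidean_space \<Rightarrow> real"
  assumes "\<And>x. x \<in> S \<Longrightarrow> f x \<noteq> 0"
  shows "Ck_on k S f \<Longrightarrow> Ck_on k S (\<lambda>x. inverse (f x))"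
proof (induction k)
  case 0
  then show ?case using assms by (auto intro: continuous_intros)
next
  case (Suc k)
  from Suc.prems obtain f' where der:
    "\<forall>x\<in>S. (f has_derivative f' x) (at x within S)" "\<forall>u. Ck_on k S (\<lambda>x. f' x u)"
    unfolding Ck_on.simps by blast
  have inv: "Ck_on k S (\<lambda>x. inverse (f x))"
    using Suc.IH Suc.prems Ck_on_Suc_imp by blast
  have "Ck_on k S (\<lambda>x. 0 - inverse (f x) * f' x u * inverse (f x))" for u
    by (intro Ck_on_diff Ck_on_mult Ck_on_const inv der(2)[rule_format])
  moreover have "((\<lambda>x. inverse (f x)) has_derivative (\<lambda>u. - (inverse (f x) * f' x u * inverse (f x))))
      (at x within S)" if "x \<in> S" for x
    using Deriv.has_derivative_inverse[of f x "f' x" S] assms that der(1) by blast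
  ultimately show ?case
    by (simp, intro exI[of _ "\<lambda>x u. - (inverse (f x) * f' x u * inverse (f x))"]) simp
qed

lemma Ck_on_inner:
  fixes f :: "'a::euclidean_space \<Rightarrow> 'b::real_inner"
  shows "Ck_on k S f \<Longrightarrow> Ck_on k S (\<lambda>x. f x \<bullet> b)"
proof (induction k arbitrary: f)
  case 0
  then show ?case by (auto intro: continuous_intros)
next
  case (Suc k)
  then obtain f' where
    "\<forall>x\<in>S. (f has_derivative f' x) (at x within S)" "\<forall>u. Ck_on k S (\<lambda>x. f' x u)"
    unfolding Ck_on.simps by blast
  then show ?case
    by (simp, intro exI[of _ "\<lambda>x u. f' x u \<bullet> b"]) (auto intro!: has_derivative_inner_left Suc.IH)
qed

lemma has_derivative_eq_sum_Basis:
  fixes f' :: "'a::euclidean_space \<Rightarrow> 'b::real_normed_vector"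
  assumes "linear f'"
  shows "f' u = (\<Sum>b\<in>Basis. (u \<bullet> b) *\<^sub>R f' b)"
proof -
  have "f' u = f' (\<Sum>b\<in>Basis. (u \<bullet> b) *\<^sub>R b)" by (simp add: euclidean_representation)
  also have "\<dots> = (\<Sum>b\<in>Basis. (u \<bullet> b) *\<^sub>R f' b)"
    by (simp add: linear_sum[OF assms] linear_scale[OF assms])
  finally show ?thesis .
qed

text \<open>The chain rule gives \<open>(g \<circ> f)' x u = g' (f x) (f' x u)\<close>. Expanding \<open>f' x u\<close> in a basis turns
  this into a sum of products of functions for which the induction hypothesis is available.\<close>

lemma Ck_on_compose:
  fixes f :: "'a::euclidean_space \<Rightarrow> 'b::euclidean_space" and g :: "'b \<Rightarrow> 'c::real_normed_vector"
  shows "Ck_on k T g \<Longrightarrow> Ck_on k S f \<Longrightarrow> f ` S \<subseteq> T \<Longrightarrow> Ck_on k S (\<lambda>x. g (f x))"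
proof (induction k arbitrary: g)
  case 0
  then show ?case by (auto intro: continuous_on_compose2)
next
  case (Suc k)
  from Suc.prems(1) obtain g' where g':
    "\<forall>y\<in>T. (g has_derivative g' y) (at y within T)" "\<forall>u. Ck_on k T (\<lambda>y. g' y u)"
    unfolding Ck_on.simps by blast
  from Suc.prems(2) obtain f' where f':
    "\<forall>x\<in>S. (f has_derivative f' x) (at x within S)" "\<forall>u. Ck_on k S (\<lambda>x. f' x u)"
    unfolding Ck_on.simps by blast
  have fk: "Ck_on k S f" using Suc.prems(2) Ck_on_Suc_imp by blast
  have der: "((\<lambda>x. g (f x)) has_derivative (\<lambda>u. g' (f x) (f' x u))) (at x within S)" if "x \<in> S" for x
    using has_derivative_in_compose2[of T g g' f S x "f' x"] that Suc.prems(3) g'(1) f'(1) by blast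
  have "Ck_on k S (\<lambda>x. g' (f x) (f' x u))" for u
  proof -
    have "Ck_on k S (\<lambda>x. \<Sum>b\<in>Basis. (f' x u \<bullet> b) *\<^sub>R g' (f x) b)"
      by (intro Ck_on_sum Ck_on_scaleR Ck_on_inner Suc.IH g'(2)[rule_format] f'(2)[rule_format]
          fk Suc.prems(3))
    moreover have "g' (f x) (f' x u) = (\<Sum>b\<in>Basis. (f' x u \<bullet> b) *\<^sub>R g' (f x) b)" if "x \<in> S" for x
      using that Suc.prems(3) g'(1) has_derivative_linear
      by (intro has_derivative_eq_sum_Basis) blast
    ultimately show ?thesis by (simp cong: Ck_on_cong)
  qed
  with der show ?case
    unfolding Ck_on.simps by (intro exI[of _ "\<lambda>x u. g' (f x) (f' x u)"]) simp
qed

lemma frechet_derivative_worksI: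
  "f differentiable net \<Longrightarrow> (f has_derivative frechet_derivative f net) net"
  using frechet_derivative_works by blast

text \<open>On an open set the derivative is unique, so the existentially quantified derivative in the
  definition of \<^const>\<open>Ck_on\<close> can be replaced by the Frechet derivative.\<close>

lemma Ck_on_Suc_open:
  assumes "open S"
  shows "Ck_on (Suc k) S f \<longleftrightarrow>
    (\<forall>x\<in>S. f differentiable (at x)) \<and> (\<forall>u. Ck_on k S (\<lambda>x. frechet_derivative f (at x) u))"
    (is "?l \<longleftrightarrow> ?r")
proof
  assume ?l
  then obtain f' where "\<forall>x\<in>S. (f has_derivative f' x) (at x within S)"
      and k: "\<And>u. Ck_on k S (\<lambda>x. f' x u)"
    by auto
  then have f': "\<And>x. x \<in> S \<Longrightarrow> (f has_derivative f' x) (at x)"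
    using assms at_within_open by metis
  have "frechet_derivative f (at x) = f' x" if "x \<in> S" for x
    using f'[OF that] frechet_derivative_at by metis
  then have "Ck_on k S (\<lambda>x. frechet_derivative f (at x) u)" for u
    using k[of u] by (simp cong: Ck_on_cong)
  then show ?r using f' differentiable_def by blast
next
  assume ?r
  then show ?l
    unfolding Ck_on.simps
    by (intro exI[of _ "\<lambda>x. frechet_derivative f (at x)"])
      (simp add: frechet_derivative_worksI has_derivative_at_withinI)
qed

text \<open>The local witnesses for the derivative agree on overlaps because all of them are the Frechet
  derivative; this reduces regularity on a chart domain to regularity near each point.\<close>

lemma Ck_on_local:
  assumes "open S" "\<And>x. x \<in> S \<Longrightarrow> \<exists>U. open U \<and> x \<in> U \<and> U \<subseteq> S \<and> Ck_on k U f"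
  shows "Ck_on k S f"
  using assms(2)
proof (induction k arbitrary: f)
  case 0
  have "isCont f x" if x: "x \<in> S" for x
  proof -
    obtain U where "open U" "x \<in> U" "continuous_on U f" using 0 x by auto
    then show ?thesis by (simp add: continuous_on_eq_continuous_at)
  qed
  then show ?case by (simp add: continuous_at_imp_continuous_on)
next
  case (Suc k)
  have "f differentiable (at x)" if x: "x \<in> S" for x
  proof -
    obtain U where "open U" "x \<in> U" "Ck_on (Suc k) U f" using Suc.prems x by blast
    then show ?thesis using Ck_on_Suc_open by blast
  qed
  moreover have "Ck_on k S (\<lambda>x. frechet_derivative f (at x) u)" for u
  proof (rule Suc.IH)
    fix x assume "x \<in> S"
    then obtain U where U: "open U" "x \<in> U" "U \<subseteq> S" "Ck_on (Suc k) U f" using Suc.prems by blast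
    then have "Ck_on k U (\<lambda>x. frechet_derivative f (at x) u)" using Ck_on_Suc_open by blast
    with U show "\<exists>U. open U \<and> x \<in> U \<and> U \<subseteq> S \<and> Ck_on k U (\<lambda>x. frechet_derivative f (at x) u)" by blast
  qed
  ultimately show ?case using Ck_on_Suc_open[OF assms(1)] by blast
qed

lemma Ck_on_Pair_const: "Ck_on k U (\<lambda>x::'e::euclidean_space. (t::real, x))"
proof -
  have "bounded_linear (\<lambda>x::'e. (0::real, x))"
    by (intro bounded_linear_Pair bounded_linear_zero bounded_linear_ident)
  then have "Ck_on k U (\<lambda>x. (t, 0) + (0, x))"
    by (intro Ck_on_add Ck_on_const Ck_on_bounded_linear)
  then show ?thesis by simp
qed

section \<open>Symmetry of second derivatives at boundary points\<close>

text \<open>The mean value theorem is applied to \<open>f (\<cdot> + h \<beta>) - f\<close> along \<open>\<alpha>\<close> and then to the derivative of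
  \<open>f\<close> in direction \<open>\<alpha>\<close> along \<open>\<beta>\<close>. All points involved lie in the square spanned at its corner
  \<open>z\<close> by \<open>h \<alpha>\<close> and \<open>h \<beta>\<close>, so \<open>z\<close> may be a boundary point of \<open>S\<close>.\<close>

lemma second_difference_mean_value:
  fixes f :: "'a::real_normed_vector \<Rightarrow> real"
  assumes f': "\<And>y. y \<in> S \<Longrightarrow> (f has_derivative f' y) (at y within S)"
    and A: "\<And>y. y \<in> S \<Longrightarrow> ((\<lambda>y. f' y \<alpha>) has_derivative A y) (at y within S)"
    and h: "0 < h"
    and S: "\<And>\<sigma> \<tau>. 0 \<le> \<sigma> \<Longrightarrow> \<sigma> \<le> h \<Longrightarrow> 0 \<le> \<tau> \<Longrightarrow> \<tau> \<le> h \<Longrightarrow> z + \<sigma> *\<^sub>R \<alpha> + \<tau> *\<^sub>R \<beta> \<in> S"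
  obtains \<sigma> \<tau> where "0 \<le> \<sigma>" "\<sigma> \<le> h" "0 \<le> \<tau>" "\<tau> \<le> h"
    "f (z + h *\<^sub>R \<alpha> + h *\<^sub>R \<beta>) - f (z + h *\<^sub>R \<alpha>) - f (z + h *\<^sub>R \<beta>) + f z
      = h^2 * A (z + \<sigma> *\<^sub>R \<alpha> + \<tau> *\<^sub>R \<beta>) \<beta>"
proof -
  have d1: "((\<lambda>\<sigma>. f (z + \<sigma> *\<^sub>R \<alpha> + \<tau> *\<^sub>R \<beta>)) has_derivative
        (\<lambda>k. f' (z + \<sigma> *\<^sub>R \<alpha> + \<tau> *\<^sub>R \<beta>) (k *\<^sub>R \<alpha>))) (at \<sigma> within {0..h})"
    if "0 \<le> \<sigma>" "\<sigma> \<le> h" "0 \<le> \<tau>" "\<tau> \<le> h" for \<sigma> \<tau>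
    using that S by (intro has_derivative_in_compose2[OF f'])
      (auto intro!: derivative_eq_intros)
  have "\<exists>\<sigma>\<in>{0<..<h}. (f (z + h *\<^sub>R \<alpha> + h *\<^sub>R \<beta>) - f (z + h *\<^sub>R \<alpha> + 0 *\<^sub>R \<beta>))
      - (f (z + 0 *\<^sub>R \<alpha> + h *\<^sub>R \<beta>) - f (z + 0 *\<^sub>R \<alpha> + 0 *\<^sub>R \<beta>))
      = f' (z + \<sigma> *\<^sub>R \<alpha> + h *\<^sub>R \<beta>) ((h - 0) *\<^sub>R \<alpha>) - f' (z + \<sigma> *\<^sub>R \<alpha> + 0 *\<^sub>R \<beta>) ((h - 0) *\<^sub>R \<alpha>)"
    by (rule mvt_simple[OF h]) (intro has_derivative_diff d1; use h in simp)+
  then obtain \<sigma> where \<sigma>: "0 < \<sigma>" "\<sigma> < h"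
    and eq1: "f (z + h *\<^sub>R \<alpha> + h *\<^sub>R \<beta>) - f (z + h *\<^sub>R \<alpha>) - f (z + h *\<^sub>R \<beta>) + f z
      = f' (z + \<sigma> *\<^sub>R \<alpha> + h *\<^sub>R \<beta>) (h *\<^sub>R \<alpha>) - f' (z + \<sigma> *\<^sub>R \<alpha>) (h *\<^sub>R \<alpha>)"
    by auto
  have d2: "((\<lambda>\<tau>. f' (z + \<sigma> *\<^sub>R \<alpha> + \<tau> *\<^sub>R \<beta>) \<alpha>) has_derivative
        (\<lambda>k. A (z + \<sigma> *\<^sub>R \<alpha> + \<tau> *\<^sub>R \<beta>) (k *\<^sub>R \<beta>))) (at \<tau> within {0..h})"
    if "0 \<le> \<tau>" "\<tau> \<le> h" for \<tau>
    using that S \<sigma> by (intro has_derivative_in_compose2[OF A])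
      (auto intro!: derivative_eq_intros)
  have "\<exists>\<tau>\<in>{0<..<h}. f' (z + \<sigma> *\<^sub>R \<alpha> + h *\<^sub>R \<beta>) \<alpha> - f' (z + \<sigma> *\<^sub>R \<alpha> + 0 *\<^sub>R \<beta>) \<alpha>
      = A (z + \<sigma> *\<^sub>R \<alpha> + \<tau> *\<^sub>R \<beta>) ((h - 0) *\<^sub>R \<beta>)"
    by (rule mvt_simple[OF h]) (intro d2; simp)
  then obtain \<tau> where \<tau>: "0 < \<tau>" "\<tau> < h"
    and eq2: "f' (z + \<sigma> *\<^sub>R \<alpha> + h *\<^sub>R \<beta>) \<alpha> - f' (z + \<sigma> *\<^sub>R \<alpha>) \<alpha>
      = A (z + \<sigma> *\<^sub>R \<alpha> + \<tau> *\<^sub>R \<beta>) (h *\<^sub>R \<beta>)"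
    by auto
  have lin: "linear (f' (z + \<sigma> *\<^sub>R \<alpha> + h *\<^sub>R \<beta>))" "linear (f' (z + \<sigma> *\<^sub>R \<alpha>))"
    "linear (A (z + \<sigma> *\<^sub>R \<alpha> + \<tau> *\<^sub>R \<beta>))"
    using S[of \<sigma> h] S[of \<sigma> 0] S[of \<sigma> \<tau>] \<sigma> \<tau> h f' A has_derivative_linear
    by (force, force, force)
  show thesis
  proof (rule that[of \<sigma> \<tau>])
    show "f (z + h *\<^sub>R \<alpha> + h *\<^sub>R \<beta>) - f (z + h *\<^sub>R \<alpha>) - f (z + h *\<^sub>R \<beta>) + f z
      = h^2 * A (z + \<sigma> *\<^sub>R \<alpha> + \<tau> *\<^sub>R \<beta>) \<beta>"
      using eq1 eq2 lin by (simp add: linear_scale power2_eq_square flip: right_diff_distrib)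
  qed (use \<sigma> \<tau> in auto)
qed

text \<open>The second difference of \<open>f\<close> over a square of side \<open>h\<close> does not see the order of \<open>\<alpha>\<close> and \<open>\<beta>\<close>. Divided
  by \<open>h\<^sup>2\<close>, it is a value of either mixed second derivative near the corner \<open>z\<close>; continuity and
  \<open>h \<rightarrow> 0\<close> give the equality at \<open>z\<close>.\<close>

lemma symmetric_second_derivative_real:
  fixes f :: "'a::real_normed_vector \<Rightarrow> real"
  assumes f': "\<And>y. y \<in> S \<Longrightarrow> (f has_derivative f' y) (at y within S)"
    and A: "\<And>y. y \<in> S \<Longrightarrow> ((\<lambda>y. f' y \<alpha>) has_derivative A y) (at y within S)"
    and B: "\<And>y. y \<in> S \<Longrightarrow> ((\<lambda>y. f' y \<beta>) has_derivative B y) (at y within S)"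
    and contA: "continuous_on S (\<lambda>y. A y \<beta>)" and contB: "continuous_on S (\<lambda>y. B y \<alpha>)"
    and \<delta>: "0 < \<delta>"
    and S: "\<And>\<sigma> \<tau>. 0 \<le> \<sigma> \<Longrightarrow> \<sigma> \<le> \<delta> \<Longrightarrow> 0 \<le> \<tau> \<Longrightarrow> \<tau> \<le> \<delta> \<Longrightarrow> z + \<sigma> *\<^sub>R \<alpha> + \<tau> *\<^sub>R \<beta> \<in> S"
  shows "A z \<beta> = B z \<alpha>"
proof -
  \<comment> \<open>A continuous function varies by less than \<open>e\<close> over all small squares with corner \<open>z\<close>.\<close>
  have near: "\<exists>r>0. \<forall>h \<sigma> \<tau>. 0 < h \<longrightarrow> h \<le> r \<longrightarrow> 0 \<le> \<sigma> \<longrightarrow> \<sigma> \<le> h \<longrightarrow> 0 \<le> \<tau> \<longrightarrow> \<tau> \<le> h \<longrightarrow>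
      \<bar>G (z + \<sigma> *\<^sub>R \<alpha> + \<tau> *\<^sub>R \<beta>) - G z\<bar> < e"
    if G: "continuous_on S G" and e: "e > 0" for G :: "'a \<Rightarrow> real" and e
  proof -
    have "z \<in> S" using S[of 0 0] \<delta> by simp
    then obtain d where d: "d > 0" "\<And>y. y \<in> S \<Longrightarrow> dist y z < d \<Longrightarrow> dist (G y) (G z) < e"
      using G e unfolding continuous_on_iff by meson
    \<comment> \<open>The square of side \<open>h\<close> lies within distance \<open>h (\<bar>\<alpha>\<bar> + \<bar>\<beta>\<bar>)\<close> of its corner.\<close>
    define r where "r = min \<delta> (d / 2 / (1 + norm \<alpha> + norm \<beta>))"
    have pos: "0 < 1 + norm \<alpha> + norm \<beta>" by (simp add: add_pos_nonneg)
    have "dist (z + \<sigma> *\<^sub>R \<alpha> + \<tau> *\<^sub>R \<beta>) z < d"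
      if "0 < h" "h \<le> r" "0 \<le> \<sigma>" "\<sigma> \<le> h" "0 \<le> \<tau>" "\<tau> \<le> h" for h \<sigma> \<tau>
    proof -
      have "dist (z + \<sigma> *\<^sub>R \<alpha> + \<tau> *\<^sub>R \<beta>) z = norm (\<sigma> *\<^sub>R \<alpha> + \<tau> *\<^sub>R \<beta>)"
        by (simp add: dist_norm add.assoc)
      also have "\<dots> \<le> \<sigma> * norm \<alpha> + \<tau> * norm \<beta>"
        using that by (intro order_trans[OF norm_triangle_ineq]) simp
      also have "\<dots> \<le> h * norm \<alpha> + h * norm \<beta>"
        using that by (intro add_mono mult_right_mono) auto
      also have "\<dots> \<le> h * (1 + norm \<alpha> + norm \<beta>)" using that by (simp add: algebra_simps)
      also have "\<dots> \<le> d / 2 / (1 + norm \<alpha> + norm \<beta>) * (1 + norm \<alpha> + norm \<beta>)"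
        using that pos by (intro mult_right_mono) (auto simp: r_def)
      also have "\<dots> = d / 2" using pos by (intro nonzero_eq_divide_eq[THEN iffD1, OF _ refl]) simp
      also have "\<dots> < d" using d(1) by simp
      finally show ?thesis .
    qed
    moreover have "z + \<sigma> *\<^sub>R \<alpha> + \<tau> *\<^sub>R \<beta> \<in> S"
      if "h \<le> r" "0 \<le> \<sigma>" "\<sigma> \<le> h" "0 \<le> \<tau>" "\<tau> \<le> h" for h \<sigma> \<tau>
      using that by (intro S) (auto simp: r_def)
    ultimately have "\<bar>G (z + \<sigma> *\<^sub>R \<alpha> + \<tau> *\<^sub>R \<beta>) - G z\<bar> < e"
      if "0 < h" "h \<le> r" "0 \<le> \<sigma>" "\<sigma> \<le> h" "0 \<le> \<tau>" "\<tau> \<le> h" for h \<sigma> \<tau>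
      using d(2) that unfolding dist_real_def by blast
    moreover have "r > 0" using \<delta> d(1) pos by (simp add: r_def)
    ultimately show ?thesis by blast
  qed
  have "\<bar>A z \<beta> - B z \<alpha>\<bar> < e" if e: "e > 0" for e
  proof -
    obtain r1 where r1: "r1 > 0" "\<And>h \<sigma> \<tau>. 0 < h \<Longrightarrow> h \<le> r1 \<Longrightarrow> 0 \<le> \<sigma> \<Longrightarrow> \<sigma> \<le> h \<Longrightarrow> 0 \<le> \<tau> \<Longrightarrow> \<tau> \<le> h \<Longrightarrow>
      \<bar>A (z + \<sigma> *\<^sub>R \<alpha> + \<tau> *\<^sub>R \<beta>) \<beta> - A z \<beta>\<bar> < e / 2"
      using near[OF contA, of "e / 2"] e by auto
    obtain r2 where r2: "r2 > 0" "\<And>h \<sigma> \<tau>. 0 < h \<Longrightarrow> h \<le> r2 \<Longrightarrow> 0 \<le> \<sigma> \<Longrightarrow> \<sigma> \<le> h \<Longrightarrow> 0 \<le> \<tau> \<Longrightarrow> \<tau> \<le> h \<Longrightarrow>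
      \<bar>B (z + \<sigma> *\<^sub>R \<alpha> + \<tau> *\<^sub>R \<beta>) \<alpha> - B z \<alpha>\<bar> < e / 2"
      using near[OF contB, of "e / 2"] e by auto
    define h where "h = min \<delta> (min r1 r2)"
    have h: "0 < h" "h \<le> \<delta>" "h \<le> r1" "h \<le> r2" using r1(1) r2(1) \<delta> by (auto simp: h_def)
    have Sh: "z + \<sigma> *\<^sub>R \<alpha> + \<tau> *\<^sub>R \<beta> \<in> S" "z + \<tau> *\<^sub>R \<beta> + \<sigma> *\<^sub>R \<alpha> \<in> S"
      if "0 \<le> \<sigma>" "\<sigma> \<le> h" "0 \<le> \<tau>" "\<tau> \<le> h" for \<sigma> \<tau>
      using S[of \<sigma> \<tau>] that h(2) by (auto simp: add_ac)
    obtain \<sigma> \<tau> where 1: "0 \<le> \<sigma>" "\<sigma> \<le> h" "0 \<le> \<tau>" "\<tau> \<le> h"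
      "f (z + h *\<^sub>R \<alpha> + h *\<^sub>R \<beta>) - f (z + h *\<^sub>R \<alpha>) - f (z + h *\<^sub>R \<beta>) + f z
        = h^2 * A (z + \<sigma> *\<^sub>R \<alpha> + \<tau> *\<^sub>R \<beta>) \<beta>"
      using second_difference_mean_value[OF f' A h(1) Sh(1)] by blast
    obtain \<tau>' \<sigma>' where 2: "0 \<le> \<sigma>'" "\<sigma>' \<le> h" "0 \<le> \<tau>'" "\<tau>' \<le> h"
      "f (z + h *\<^sub>R \<beta> + h *\<^sub>R \<alpha>) - f (z + h *\<^sub>R \<beta>) - f (z + h *\<^sub>R \<alpha>) + f z
        = h^2 * B (z + \<tau>' *\<^sub>R \<beta> + \<sigma>' *\<^sub>R \<alpha>) \<alpha>"
      using second_difference_mean_value[OF f' B h(1) Sh(2)] by blast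
    have "z + h *\<^sub>R \<beta> + h *\<^sub>R \<alpha> = z + h *\<^sub>R \<alpha> + h *\<^sub>R \<beta>"
      "z + \<tau>' *\<^sub>R \<beta> + \<sigma>' *\<^sub>R \<alpha> = z + \<sigma>' *\<^sub>R \<alpha> + \<tau>' *\<^sub>R \<beta>" by (simp_all add: add_ac)
    then have "h^2 * A (z + \<sigma> *\<^sub>R \<alpha> + \<tau> *\<^sub>R \<beta>) \<beta> = h^2 * B (z + \<sigma>' *\<^sub>R \<alpha> + \<tau>' *\<^sub>R \<beta>) \<alpha>"
      using 1(5) 2(5) by (simp add: algebra_simps)
    with h(1) have "A (z + \<sigma> *\<^sub>R \<alpha> + \<tau> *\<^sub>R \<beta>) \<beta> = B (z + \<sigma>' *\<^sub>R \<alpha> + \<tau>' *\<^sub>R \<beta>) \<alpha>"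
      by simp
    then show ?thesis
      using r1(2)[OF h(1) h(3) 1(1-4)] r2(2)[OF h(1) h(4) 2(1-4)] by linarith
  qed
  then show ?thesis by (metis less_irrefl zero_less_abs_iff eq_iff_diff_eq_0)
qed

lemma symmetric_second_derivative:
  fixes f :: "'a::real_normed_vector \<Rightarrow> 'b::euclidean_space"
  assumes f': "\<And>y. y \<in> S \<Longrightarrow> (f has_derivative f' y) (at y within S)"
    and A: "\<And>y. y \<in> S \<Longrightarrow> ((\<lambda>y. f' y \<alpha>) has_derivative A y) (at y within S)"
    and B: "\<And>y. y \<in> S \<Longrightarrow> ((\<lambda>y. f' y \<beta>) has_derivative B y) (at y within S)"
    and contA: "continuous_on S (\<lambda>y. A y \<beta>)" and contB: "continuous_on S (\<lambda>y. B y \<alpha>)"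
    and \<delta>: "0 < \<delta>"
    and S: "\<And>\<sigma> \<tau>. 0 \<le> \<sigma> \<Longrightarrow> \<sigma> \<le> \<delta> \<Longrightarrow> 0 \<le> \<tau> \<Longrightarrow> \<tau> \<le> \<delta> \<Longrightarrow> z + \<sigma> *\<^sub>R \<alpha> + \<tau> *\<^sub>R \<beta> \<in> S"
  shows "A z \<beta> = B z \<alpha>"
proof (rule euclidean_eqI)
  fix b :: 'b
  show "A z \<beta> \<bullet> b = B z \<alpha> \<bullet> b"
    by (rule symmetric_second_derivative_real[where S = S and f = "\<lambda>y. f y \<bullet> b"
          and f' = "\<lambda>y u. f' y u \<bullet> b" and A = "\<lambda>y u. A y u \<bullet> b" and B = "\<lambda>y u. B y u \<bullet> b"])
      (use assms in \<open>auto intro!: has_derivative_inner_left continuous_intros\<close>)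
qed

section \<open>Derivatives on the product of an interval and an open set\<close>

lemma at_within_Int_open: "open O' \<Longrightarrow> z \<in> O' \<Longrightarrow> at z within (T \<inter> O') = at z within T"
  by (rule at_within_nhd[of z O']) auto

text \<open>The direction \<open>\<sigma>\<close> points into the interval; it is needed at an end point, where only one sign is
  possible.\<close>

lemma interval_inward_direction:
  fixes I :: "real set"
  assumes "is_interval I" "t \<in> I" "t' \<in> I" "t \<noteq> t'"
  obtains \<sigma> where "\<sigma> \<noteq> 0" "\<And>h. 0 \<le> h \<Longrightarrow> h \<le> 1 \<Longrightarrow> t + h * \<sigma> \<in> I"
proof (rule that[of "t' - t"])
  fix h :: real assume h: "0 \<le> h" "h \<le> 1"
  have "convex I" using assms(1) is_interval_convex by blast
  then have "(1 - h) *\<^sub>R t + h *\<^sub>R t' \<in> I"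
    using convexD_alt[OF _ assms(2,3), of h] h by blast
  moreover have "(1 - h) *\<^sub>R t + h *\<^sub>R t' = t + h * (t' - t)" by (simp add: algebra_simps)
  ultimately show "t + h * (t' - t) \<in> I" by metis
qed (use assms in simp)

lemma interval_at_within_nontrivial:
  fixes I :: "real set"
  assumes "is_interval I" "t \<in> I" "t' \<in> I" "t \<noteq> t'"
  shows "at t within I \<noteq> bot"
  using connected_imp_perfect[of I t] assms is_interval_connected trivial_limit_within by blast

lemma has_derivative_time_slice:
  fixes g :: "real \<times> 'e::euclidean_space \<Rightarrow> 'b::real_normed_vector"
  assumes g: "(g has_derivative g') (at (t, x) within (I \<times> UNIV) \<inter> W)"
    and W: "open W" "(t, x) \<in> W"
  shows "((\<lambda>s. g (s, x)) has_vector_derivative g' (1, 0)) (at t within I)"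
proof -
  let ?J = "{s. (s, x) \<in> W}"
  have "open ?J" using open_vimage[OF W(1), of "\<lambda>s. (s, x)"] by (simp add: vimage_def continuous_intros)
  have "((\<lambda>s. (s, x)) has_derivative (\<lambda>k. (k, 0))) (at t within I \<inter> ?J)"
    by (auto intro!: derivative_eq_intros)
  moreover have "(g has_derivative g') (at (t, x) within (\<lambda>s. (s, x)) ` (I \<inter> ?J))"
    using g by (rule has_derivative_subset) auto
  ultimately have "((\<lambda>s. g (s, x)) has_derivative (\<lambda>k. g' (k, 0))) (at t within I \<inter> ?J)"
    by (rule has_derivative_in_compose)
  moreover have "at t within I \<inter> ?J = at t within I"
    using \<open>open ?J\<close> W(2) by (intro at_within_Int_open) auto
  moreover have "(\<lambda>k. g' (k, 0)) = (\<lambda>k. k *\<^sub>R g' (1, 0))"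
  proof
    fix k show "g' (k, 0) = k *\<^sub>R g' (1, 0)"
      using linear_scale[OF has_derivative_linear[OF g], of k "(1, 0)"] by simp
  qed
  ultimately show ?thesis by (simp add: has_vector_derivative_def)
qed

lemma has_derivative_space_slice:
  fixes g :: "real \<times> 'e::euclidean_space \<Rightarrow> 'b::real_normed_vector"
  assumes g: "(g has_derivative g') (at (t, x) within (I \<times> UNIV) \<inter> W)"
    and W: "open W" "(t, x) \<in> W" and t: "t \<in> I"
  shows "((\<lambda>y. g (t, y)) has_derivative (\<lambda>\<eta>. g' (0, \<eta>))) (at x)"
proof -
  let ?U = "{y. (t, y) \<in> W}"
  have "open ?U" using open_vimage[OF W(1), of "\<lambda>y. (t, y)"] by (simp add: vimage_def continuous_intros)
  have "((\<lambda>y. (t, y)) has_derivative (\<lambda>\<eta>. (0, \<eta>))) (at x within ?U)"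
    by (auto intro!: derivative_eq_intros)
  moreover have "(g has_derivative g') (at (t, x) within (\<lambda>y. (t, y)) ` ?U)"
    using g t by (elim has_derivative_subset) auto
  ultimately have "((\<lambda>y. g (t, y)) has_derivative (\<lambda>\<eta>. g' (0, \<eta>))) (at x within ?U)"
    by (rule has_derivative_in_compose)
  moreover have "at x within ?U = at x" using \<open>open ?U\<close> W(2) by (intro at_within_open) auto
  ultimately show ?thesis by simp
qed

lemma linear_Pair_split:
  assumes "linear f"
  shows "f (a, b) = a *\<^sub>R f (1, 0) + f (0, b)"
  using linear_add[OF assms, of "(a, 0)" "(0, b)"] linear_scale[OF assms, of a "(1, 0)"] by simp

text \<open>A derivative within a strip is determined by its restrictions to the time axis and to the space
  of the second factor, and both restrictions are unique, the first one as a possibly one-sided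
  derivative in the interval.\<close>

lemma has_derivative_strip_unique:
  fixes g :: "real \<times> 'e::euclidean_space \<Rightarrow> 'b::real_normed_vector"
  assumes D1: "(g has_derivative D1) (at (t, x) within (I \<times> UNIV) \<inter> W)"
    and D2: "(g has_derivative D2) (at (t, x) within (I \<times> UNIV) \<inter> W)"
    and W: "open W" "(t, x) \<in> W" and t: "t \<in> I" and I: "at t within I \<noteq> bot"
  shows "D1 = D2"
proof -
  have "D1 (1, 0) = D2 (1, 0)"
    using has_derivative_time_slice[OF D1 W] has_derivative_time_slice[OF D2 W]
      vector_derivative_unique_within[OF I] by blast
  moreover have "(\<lambda>\<eta>. D1 (0, \<eta>)) = (\<lambda>\<eta>. D2 (0, \<eta>))"
    using has_derivative_space_slice[OF D1 W t] has_derivative_space_slice[OF D2 W t]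
      has_derivative_unique by blast
  ultimately have "D1 (a, b) = D2 (a, b)" for a b
    using linear_Pair_split[OF has_derivative_linear[OF D1], of a b]
      linear_Pair_split[OF has_derivative_linear[OF D2], of a b] by (metis (no_types))
  then show ?thesis by (simp add: fun_eq_iff)
qed

section \<open>Conformal pullbacks along a family of maps in coordinates\<close>

lemma bilinear_eq_sum_Basis:
  fixes \<gamma> :: "'a::euclidean_space \<Rightarrow> 'a \<Rightarrow> real"
  assumes "bilinear \<gamma>"
  shows "\<gamma> a b = (\<Sum>i\<in>Basis. \<Sum>j\<in>Basis. (a \<bullet> i) * (b \<bullet> j) * \<gamma> i j)"
proof -
  have "\<gamma> a b = (\<Sum>i\<in>Basis. (a \<bullet> i) * \<gamma> i b)"
    using has_derivative_eq_sum_Basis[of "\<lambda>a. \<gamma> a b" a] assms by (simp add: bilinear_def)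
  moreover have "\<gamma> i b = (\<Sum>j\<in>Basis. (b \<bullet> j) * \<gamma> i j)" for i
    using has_derivative_eq_sum_Basis[of "\<gamma> i" b] assms by (simp add: bilinear_def)
  ultimately show ?thesis by (simp add: sum_distrib_left mult.assoc)
qed

text \<open>The Leibniz rule for a form with variable coefficients evaluated on variable vectors. Here \<open>P\<close> is
  the derivative of the coefficients, with both vectors kept constant. For a
  direction \<open>h\<close> with \<open>f' h = 0\<close>, along which \<open>f\<close> is stationary, that term vanishes.\<close>

lemma has_derivative_bilinear_field:
  fixes \<gamma> :: "'e::euclidean_space \<Rightarrow> 'e \<Rightarrow> 'e \<Rightarrow> real" and f a b :: "'z::real_normed_vector \<Rightarrow> 'e"
  assumes bil: "\<And>y. y \<in> T \<Longrightarrow> bilinear (\<gamma> y)"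
    and diff: "\<And>y u w. y \<in> T \<Longrightarrow> (\<lambda>y. \<gamma> y u w) differentiable (at y)"
    and fT: "f ` S \<subseteq> T" and z: "z \<in> S"
    and f: "(f has_derivative f') (at z within S)"
    and a: "(a has_derivative a') (at z within S)"
    and b: "(b has_derivative b') (at z within S)"
  obtains P where "P 0 = 0"
    "((\<lambda>z. \<gamma> (f z) (a z) (b z)) has_derivative
      (\<lambda>h. P (f' h) + \<gamma> (f z) (a' h) (b z) + \<gamma> (f z) (a z) (b' h))) (at z within S)"
proof -
  define \<Gamma> where "\<Gamma> u w = frechet_derivative (\<lambda>y. \<gamma> y u w) (at (f z))" for u w
  have \<Gamma>: "((\<lambda>y. \<gamma> y u w) has_derivative \<Gamma> u w) (at (f z))" for u w
    unfolding \<Gamma>_def using diff fT z by (intro frechet_derivative_worksI) auto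
  define P where "P \<eta> = (\<Sum>i\<in>Basis. \<Sum>j\<in>Basis. (a z \<bullet> i) * (b z \<bullet> j) * \<Gamma> i j \<eta>)" for \<eta>
  have eq: "\<gamma> (f z) u w = (\<Sum>i\<in>Basis. \<Sum>j\<in>Basis. (u \<bullet> i) * (w \<bullet> j) * \<gamma> (f z) i j)" for u w
    using bil fT z by (intro bilinear_eq_sum_Basis) auto
  have \<gamma>f: "((\<lambda>z. \<gamma> (f z) u w) has_derivative (\<lambda>h. \<Gamma> u w (f' h))) (at z within S)" for u w
    using has_derivative_compose[OF f \<Gamma>] .
  have "((\<lambda>z. \<Sum>i\<in>Basis. \<Sum>j\<in>Basis. (a z \<bullet> i) * (b z \<bullet> j) * \<gamma> (f z) i j) has_derivative
      (\<lambda>h. \<Sum>i\<in>Basis. \<Sum>j\<in>Basis. (a z \<bullet> i) * (b z \<bullet> j) * \<Gamma> i j (f' h)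
          + ((a z \<bullet> i) * (b' h \<bullet> j) + (a' h \<bullet> i) * (b z \<bullet> j)) * \<gamma> (f z) i j)) (at z within S)"
    by (intro has_derivative_sum has_derivative_mult has_derivative_inner_left a b \<gamma>f)
  also have "(\<lambda>h. \<Sum>i\<in>Basis. \<Sum>j\<in>Basis. (a z \<bullet> i) * (b z \<bullet> j) * \<Gamma> i j (f' h)
          + ((a z \<bullet> i) * (b' h \<bullet> j) + (a' h \<bullet> i) * (b z \<bullet> j)) * \<gamma> (f z) i j)
      = (\<lambda>h. P (f' h) + \<gamma> (f z) (a' h) (b z) + \<gamma> (f z) (a z) (b' h))"
    by (simp add: P_def sum.distrib algebra_simps eq[of "a' h" "b z" for h] eq[of "a z" "b' h" for h])
  finally have "((\<lambda>z. \<gamma> (f z) (a z) (b z)) has_derivative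
      (\<lambda>h. P (f' h) + \<gamma> (f z) (a' h) (b z) + \<gamma> (f z) (a z) (b' h))) (at z within S)"
  proof (rule has_derivative_transform[OF z, rotated])
    fix y assume "y \<in> S"
    then have "bilinear (\<gamma> (f y))" using fT bil by blast
    then show "\<gamma> (f y) (a y) (b y) = (\<Sum>i\<in>Basis. \<Sum>j\<in>Basis. (a y \<bullet> i) * (b y \<bullet> j) * \<gamma> (f y) i j)"
      by (rule bilinear_eq_sum_Basis)
  qed
  moreover have "P 0 = 0"
    using linear_0[OF has_derivative_linear[OF \<Gamma>]] by (simp add: P_def)
  ultimately show thesis using that by blast
qed

text \<open>In the following, \<open>f\<close> is a family of maps in coordinates, depending on \<open>(s, y)\<close>, and \<open>X\<close> is its
  velocity at time \<open>t\<close>, pulled back to the source. The hypothesis on the velocity says that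
  \<open>f' (t, y)\<close> annihilates \<open>(1, - X y)\<close> for all \<open>y\<close>: to first order, \<open>f\<close> is constant along
  \<open>\<partial>\<^sub>t - X\<close> at time \<open>t\<close>.\<close>

context
  fixes I :: "real set" and W S :: "(real \<times> 'e::euclidean_space) set"
    and t :: real and x :: 'e
    and f :: "real \<times> 'e \<Rightarrow> 'e" and f' :: "real \<times> 'e \<Rightarrow> real \<times> 'e \<Rightarrow> 'e"
    and X DX :: "'e \<Rightarrow> 'e"
  assumes S: "S = (I \<times> UNIV) \<inter> W" and W: "open W" and tx: "t \<in> I" "(t, x) \<in> W"
    and f': "\<And>z. z \<in> S \<Longrightarrow> (f has_derivative f' z) (at z within S)"
    and C1: "\<And>u. Ck_on (Suc 0) S (\<lambda>z. f' z u)"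
    and X: "(X has_derivative DX) (at x)"
    and velocity: "\<And>y. (t, y) \<in> S \<Longrightarrow> f' (t, y) (1, 0) = f' (t, y) (0, X y)"
begin

lemma C1_derivative:
  "\<exists>B. (\<forall>z\<in>S. ((\<lambda>z. f' z u) has_derivative B z) (at z within S)) \<and>
    (\<forall>v. continuous_on S (\<lambda>z. B z v))"
  using C1[of u] unfolding Ck_on.simps by blast

lemma slice_open: "open {y. (t, y) \<in> W}"
  using open_vimage[OF W, of "\<lambda>y. (t, y)"] by (simp add: vimage_def continuous_intros)

text \<open>Differentiate the identity \<open>f' (t, y) (\<sigma>, - \<sigma> X y) = 0\<close> with respect to \<open>y\<close>. The derivative falls
  on \<open>f'\<close>, with the vector \<open>(\<sigma>, - \<sigma> X x)\<close> frozen, and on \<open>X\<close>; the two contributions cancel.\<close>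

lemma second_derivative_along_transport:
  assumes A: "((\<lambda>z. f' z (\<sigma>, - \<sigma> *\<^sub>R X x)) has_derivative A) (at (t, x) within S)"
  shows "A (0, u) = \<sigma> *\<^sub>R f' (t, x) (0, DX u)"
proof -
  have txS: "(t, x) \<in> S" using S tx by auto
  have lin: "linear (f' (t, y))" if "(t, y) \<in> S" for y
    using f' that has_derivative_linear by blast
  \<comment> \<open>The basis expansion allows the product rule to be applied to the vector \<open>X y - X x\<close>, which
    vanishes at \<open>y = x\<close>, without a derivative of \<open>f'\<close> as an operator-valued map.\<close>
  have eq: "f' (t, y) (\<sigma>, - \<sigma> *\<^sub>R X x)
      = \<sigma> *\<^sub>R (\<Sum>b\<in>Basis. ((X y - X x) \<bullet> b) *\<^sub>R f' (t, y) (0, b))" if y: "(t, y) \<in> S" for y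
  proof -
    have l: "linear (\<lambda>v. f' (t, y) (0, v))"
      using lin[OF y] by (intro linearI) (simp_all flip: linear_add linear_scale)
    have "f' (t, y) (\<sigma>, - \<sigma> *\<^sub>R X x) = \<sigma> *\<^sub>R f' (t, y) (0, X y) + f' (t, y) (0, - \<sigma> *\<^sub>R X x)"
      using linear_Pair_split[OF lin[OF y]] velocity[OF y] by metis
    also have "\<dots> = \<sigma> *\<^sub>R f' (t, y) (0, X y - X x)"
      using linear_scale[OF l, of "- \<sigma>" "X x"] linear_diff[OF l, of "X y" "X x"]
      by (simp add: scaleR_diff_right)
    also have "f' (t, y) (0, X y - X x) = (\<Sum>b\<in>Basis. ((X y - X x) \<bullet> b) *\<^sub>R f' (t, y) (0, b))"
      using has_derivative_eq_sum_Basis[OF l] .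
    finally show ?thesis .
  qed
  have "((\<lambda>y. \<sigma> *\<^sub>R (\<Sum>b\<in>Basis. ((X y - X x) \<bullet> b) *\<^sub>R f' (t, y) (0, b))) has_derivative
      (\<lambda>\<eta>. \<sigma> *\<^sub>R f' (t, x) (0, DX \<eta>))) (at x)"
  proof -
    have "\<exists>C. ((\<lambda>y. f' (t, y) (0, b)) has_derivative C) (at x)" for b
    proof -
      obtain B where "((\<lambda>z. f' z (0, b)) has_derivative B) (at (t, x) within S)"
        using C1_derivative[of "(0, b)"] txS by blast
      then show ?thesis using has_derivative_space_slice[OF _ W tx(2,1)] S by blast
    qed
    then obtain C where C: "\<And>b. ((\<lambda>y. f' (t, y) (0, b)) has_derivative C b) (at x)" by metis
    have "((\<lambda>y. \<sigma> *\<^sub>R (\<Sum>b\<in>Basis. ((X y - X x) \<bullet> b) *\<^sub>R f' (t, y) (0, b))) has_derivative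
      (\<lambda>\<eta>. \<sigma> *\<^sub>R (\<Sum>b\<in>Basis. ((X x - X x) \<bullet> b) *\<^sub>R C b \<eta> + ((DX \<eta> - 0) \<bullet> b) *\<^sub>R f' (t, x) (0, b)))) (at x)"
      by (intro has_derivative_scaleR_right has_derivative_sum has_derivative_scaleR
          has_derivative_inner_left has_derivative_diff X has_derivative_const C)
    moreover have l: "linear (\<lambda>v. f' (t, x) (0, v))"
      using lin[OF txS] by (intro linearI) (simp_all flip: linear_add linear_scale)
    ultimately show ?thesis by (simp flip: has_derivative_eq_sum_Basis[OF l])
  qed
  then have "((\<lambda>y. f' (t, y) (\<sigma>, - \<sigma> *\<^sub>R X x)) has_derivative
      (\<lambda>\<eta>. \<sigma> *\<^sub>R f' (t, x) (0, DX \<eta>))) (at x)"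
    by (rule has_derivative_transform_within_open[OF _ slice_open])
      (use tx S eq in auto)
  moreover have "((\<lambda>y. f' (t, y) (\<sigma>, - \<sigma> *\<^sub>R X x)) has_derivative (\<lambda>\<eta>. A (0, \<eta>))) (at x)"
    using has_derivative_space_slice[OF A[unfolded S] W tx(2,1)] .
  ultimately have "(\<lambda>\<eta>. A (0, \<eta>)) = (\<lambda>\<eta>. \<sigma> *\<^sub>R f' (t, x) (0, DX \<eta>))"
    using has_derivative_unique by blast
  then show ?thesis by (rule fun_cong)
qed

lemma square_in_strip:
  assumes \<sigma>: "\<And>h. 0 \<le> h \<Longrightarrow> h \<le> 1 \<Longrightarrow> t + h * \<sigma> \<in> I"
  obtains \<delta> where "0 < \<delta>" "\<And>h k. 0 \<le> h \<Longrightarrow> h \<le> \<delta> \<Longrightarrow> 0 \<le> k \<Longrightarrow> k \<le> \<delta> \<Longrightarrow>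
      (t, x) + h *\<^sub>R (\<sigma>, \<xi>) + k *\<^sub>R (0, u) \<in> S"
proof -
  let ?F = "\<lambda>p::real \<times> real. (t, x) + fst p *\<^sub>R (\<sigma>, \<xi>) + snd p *\<^sub>R (0, u)"
  have "open (?F -` W)" by (intro open_vimage W continuous_intros)
  moreover have "(0, 0) \<in> ?F -` W" using tx by simp
  ultimately obtain A B where "open A" "open B" "(0, 0) \<in> A \<times> B" "A \<times> B \<subseteq> ?F -` W"
    by (rule open_prod_elim)
  then have AB: "open A" "open B" "0 \<in> A" "0 \<in> B" "A \<times> B \<subseteq> ?F -` W" by auto
  obtain a where a: "a > 0" "ball 0 a \<subseteq> A" using AB(1,3) openE by blast
  obtain b where b: "b > 0" "ball 0 b \<subseteq> B" using AB(2,4) openE by blast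
  show thesis
  proof (rule that[of "min 1 (min a b / 2)"])
    fix h k :: real
    assume hk: "0 \<le> h" "h \<le> min 1 (min a b / 2)" "0 \<le> k" "k \<le> min 1 (min a b / 2)"
    have "h \<in> ball 0 a" "k \<in> ball 0 b" using hk a(1) b(1) by (auto simp: min_def split: if_splits)
    then have "h \<in> A" "k \<in> B" using a(2) b(2) by auto
    then have "?F (h, k) \<in> W" using AB(5) by blast
    moreover have "t + h * \<sigma> \<in> I" using \<sigma> hk by simp
    ultimately show "(t, x) + h *\<^sub>R (\<sigma>, \<xi>) + k *\<^sub>R (0, u) \<in> S" by (simp add: S)
  qed (use a(1) b(1) in simp)
qed

text \<open>By the symmetry of second derivatives, the derivative of \<open>f' \<cdot> (0, u)\<close> along \<open>\<partial>\<^sub>t - X\<close> is the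
  derivative of \<open>f' \<cdot> (1, - X x)\<close> along \<open>u\<close>, which is computed by
  \<open>second_derivative_along_transport\<close>. Scaling by \<open>\<sigma>\<close> makes \<open>(1, - X x)\<close> point into the strip, so
  that the symmetry is available for \<open>t\<close> an end point of the interval.\<close>

lemma spatial_derivative_along_transport:
  assumes "\<sigma> \<noteq> 0" "\<And>h. 0 \<le> h \<Longrightarrow> h \<le> 1 \<Longrightarrow> t + h * \<sigma> \<in> I"
  obtains B where "((\<lambda>z. f' z (0, u)) has_derivative B) (at (t, x) within S)"
    "B (1, - X x) = f' (t, x) (0, DX u)"
proof -
  have txS: "(t, x) \<in> S" using S tx by auto
  define \<alpha> where "\<alpha> = (\<sigma>, - \<sigma> *\<^sub>R X x)"
  obtain A where A: "\<forall>z\<in>S. ((\<lambda>z. f' z \<alpha>) has_derivative A z) (at z within S)"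
    "\<forall>v. continuous_on S (\<lambda>z. A z v)" using C1_derivative[of \<alpha>] by blast
  obtain B where B: "\<forall>z\<in>S. ((\<lambda>z. f' z (0, u)) has_derivative B z) (at z within S)"
    "\<forall>v. continuous_on S (\<lambda>z. B z v)" using C1_derivative[of "(0, u)"] by blast
  obtain \<delta> where \<delta>: "0 < \<delta>" "\<And>h k. 0 \<le> h \<Longrightarrow> h \<le> \<delta> \<Longrightarrow> 0 \<le> k \<Longrightarrow> k \<le> \<delta> \<Longrightarrow>
      (t, x) + h *\<^sub>R \<alpha> + k *\<^sub>R (0, u) \<in> S"
    unfolding \<alpha>_def by (rule square_in_strip[OF assms(2), of "- \<sigma> *\<^sub>R X x" u]) (auto intro: that)
  have "A (t, x) (0, u) = B (t, x) \<alpha>"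
    by (rule symmetric_second_derivative[OF f' A(1)[rule_format] B(1)[rule_format]
          A(2)[rule_format] B(2)[rule_format] \<delta>])
  moreover have "A (t, x) (0, u) = \<sigma> *\<^sub>R f' (t, x) (0, DX u)"
    using second_derivative_along_transport A(1)[rule_format, OF txS] unfolding \<alpha>_def by blast
  moreover have "B (t, x) \<alpha> = \<sigma> *\<^sub>R B (t, x) (1, - X x)"
    using linear_scale[OF has_derivative_linear[OF B(1)[rule_format, OF txS]], of \<sigma> "(1, - X x)"]
    by (simp add: \<alpha>_def)
  ultimately have "B (t, x) (1, - X x) = f' (t, x) (0, DX u)" using assms(1) by simp
  then show thesis using that B(1)[rule_format, OF txS] by blast
qed

text \<open>The form \<open>G\<close> is \<open>V f\<^sup>* \<gamma>\<close> in coordinates. Differentiate it along \<open>\<partial>\<^sub>t - X\<close>: the coefficients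
  \<open>\<gamma> \<circ> f\<close> contribute nothing, since \<open>f\<close> is constant in that direction to first order; each vector
  \<open>f' (0, u)\<close> contributes \<open>f' (0, DX u)\<close>; and the conformal factor contributes a multiple of \<open>G\<close>.
  Since \<open>\<partial>\<^sub>t G\<close> is \<open>q\<close>, what remains on the left is the coordinate expression of the Lie
  derivative of \<open>G\<close> along \<open>X\<close>.\<close>

lemma conformal_pullback_time_derivative:
  fixes \<gamma> :: "'e \<Rightarrow> 'e \<Rightarrow> 'e \<Rightarrow> real" and G :: "real \<times> 'e \<Rightarrow> 'e \<Rightarrow> 'e \<Rightarrow> real"
  assumes \<sigma>: "\<sigma> \<noteq> 0" "\<And>h. 0 \<le> h \<Longrightarrow> h \<le> 1 \<Longrightarrow> t + h * \<sigma> \<in> I"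
    and I: "at t within I \<noteq> bot"
    and bil: "\<And>y. y \<in> T \<Longrightarrow> bilinear (\<gamma> y)"
    and diff: "\<And>y u w. y \<in> T \<Longrightarrow> (\<lambda>y. \<gamma> y u w) differentiable (at y)"
    and fT: "f ` S \<subseteq> T"
    and V: "(V has_derivative V') (at (t, x) within S)" "V (t, x) \<noteq> 0"
    and G: "\<And>z u w. z \<in> S \<Longrightarrow> G z u w = V z * \<gamma> (f z) (f' z (0, u)) (f' z (0, w))"
    and q: "((\<lambda>s. G (s, x) u w) has_real_derivative q) (at t within I)"
  shows "frechet_derivative (\<lambda>y. G (t, y) u w) (at x) (X x) + G (t, x) (DX u) w + G (t, x) u (DX w)
    = q - V' (1, - X x) / V (t, x) * G (t, x) u w"
proof -
  let ?z = "(t, x)"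
  have txS: "?z \<in> S" using S tx by auto
  obtain a' where a': "((\<lambda>z. f' z (0, u)) has_derivative a') (at ?z within S)"
    "a' (1, - X x) = f' ?z (0, DX u)" by (rule spatial_derivative_along_transport[OF \<sigma>])
  obtain b' where b': "((\<lambda>z. f' z (0, w)) has_derivative b') (at ?z within S)"
    "b' (1, - X x) = f' ?z (0, DX w)" by (rule spatial_derivative_along_transport[OF \<sigma>])
  let ?a = "f' ?z (0, u)" and ?b = "f' ?z (0, w)"
  obtain P where P: "P 0 = 0" "((\<lambda>z. \<gamma> (f z) (f' z (0, u)) (f' z (0, w))) has_derivative
      (\<lambda>h. P (f' ?z h) + \<gamma> (f ?z) (a' h) ?b + \<gamma> (f ?z) ?a (b' h))) (at ?z within S)"
    by (rule has_derivative_bilinear_field[OF bil diff fT txS f'[OF txS] a'(1) b'(1)])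
  define D where "D h = V ?z * (P (f' ?z h) + \<gamma> (f ?z) (a' h) ?b + \<gamma> (f ?z) ?a (b' h))
      + V' h * \<gamma> (f ?z) ?a ?b" for h
  have D: "((\<lambda>z. G z u w) has_derivative D) (at ?z within S)"
    unfolding D_def by (rule has_derivative_transform[OF txS G has_derivative_mult[OF V(1) P(2)]])
  have lin: "linear (f' ?z)" using f'[OF txS] has_derivative_linear by blast
  have "f' ?z (1, - X x) = 0"
    using linear_diff[OF lin, of "(1, 0)" "(0, X x)"] velocity[OF txS] by simp
  then have "D (1, - X x) = G ?z (DX u) w + G ?z u (DX w) + V' (1, - X x) / V ?z * G ?z u w"
    using V(2) P(1) a'(2) b'(2) by (simp add: D_def G[OF txS] algebra_simps)
  moreover have "D (1, 0) = q"
    using has_derivative_time_slice[OF D[unfolded S] W tx(2)] q vector_derivative_unique_within[OF I]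
    unfolding has_real_derivative_iff_has_vector_derivative by blast
  moreover have "D (0, X x) = frechet_derivative (\<lambda>y. G (t, y) u w) (at x) (X x)"
    using has_derivative_space_slice[OF D[unfolded S] W tx(2,1)] frechet_derivative_at by metis
  moreover have "D (1, - X x) = D (1, 0) - D (0, X x)"
    using linear_diff[OF has_derivative_linear[OF D], of "(1, 0)" "(0, X x)"] by simp
  ultimately show ?thesis by simp
qed

end

section \<open>Charts, tangent vectors and differentials\<close>

lemma has_derivative_compose_open:
  assumes "(f has_derivative f') (at x)" "(g has_derivative g') (at (f x))"
    and "open U" "x \<in> U" "\<And>y. y \<in> U \<Longrightarrow> h y = g (f y)"
  shows "(h has_derivative (\<lambda>u. g' (f' u))) (at x)"
  using has_derivative_transform_within_open[OF has_derivative_compose[OF assms(1,2)] assms(3,4)]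
    assms(5) by metis

lemma frechet_derivative_compose_open:
  assumes "f differentiable (at x)" "g differentiable (at (f x))"
    and "open U" "x \<in> U" "\<And>y. y \<in> U \<Longrightarrow> h y = g (f y)"
  shows "frechet_derivative h (at x) u
    = frechet_derivative g (at (f x)) (frechet_derivative f (at x) u)"
  using has_derivative_compose_open[OF assms(1,2)[THEN frechet_derivative_worksI] assms(3-5)]
    frechet_derivative_at by metis

lemma Ck_on_imp_differentiable:
  "Ck_on (Suc k) S f \<Longrightarrow> open S \<Longrightarrow> x \<in> S \<Longrightarrow> f differentiable (at x)"
  by (simp only: Ck_on_Suc_open)

lemma charts_atD: "c \<in> charts_at A p \<Longrightarrow> c \<in> A" "c \<in> charts_at A p \<Longrightarrow> p \<in> chart_dom c"
  by (auto simp: charts_at_def)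

lemma chart_map_in: "p \<in> chart_dom c \<Longrightarrow> chart_map c p \<in> chart_cod c"
  by (simp add: chart_cod_def)

lemma tangent_spaceI:
  assumes "\<And>c d. c \<in> charts_at A p \<Longrightarrow> d \<in> charts_at A p \<Longrightarrow>
      v d = frechet_derivative (transition c d) (at (chart_map c p)) (v c)"
    and "\<And>c. c \<notin> charts_at A p \<Longrightarrow> v c = 0"
  shows "v \<in> tangent_space A p"
  unfolding tangent_space_def mem_Collect_eq using assms by blast

lemma tangent_vector_transition:
  "v \<in> tangent_space A p \<Longrightarrow> c \<in> charts_at A p \<Longrightarrow> d \<in> charts_at A p \<Longrightarrow>
    v d = frechet_derivative (transition c d) (at (chart_map c p)) (v c)"
  unfolding tangent_space_def mem_Collect_eq by blast

lemma tangent_vector_off_charts: "v \<in> tangent_space A p \<Longrightarrow> c \<notin> charts_at A p \<Longrightarrow> v c = 0"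
  unfolding tangent_space_def mem_Collect_eq by blast

lemma C_map_Ck_on:
  "C_map A r f \<Longrightarrow> enat k \<le> r \<Longrightarrow> c \<in> A \<Longrightarrow> d \<in> A \<Longrightarrow>
    Ck_on k {x \<in> chart_cod c. f (chart_inv c x) \<in> chart_dom d} (map_in_charts c d f)"
  by (simp add: C_map_def C_on_def)

context
  fixes A :: "('m::topological_space, 'e::euclidean_space) chart set"
  assumes atlas: "smooth_atlas A"
begin

lemma charts_at_ex: "\<exists>c. c \<in> charts_at A p"
proof -
  have "p \<in> (\<Union>c\<in>A. chart_dom c)" using atlas by (simp add: smooth_atlas_def)
  then show ?thesis unfolding charts_at_def by blast
qed

lemma chart_at_in: "chart_at A p \<in> charts_at A p"
  unfolding chart_at_def using charts_at_ex by (rule someI_ex)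

lemma chart_cod_open: "c \<in> A \<Longrightarrow> open (chart_cod c)"
  using atlas by (auto simp: smooth_atlas_def)

lemma chart_dom_open: "c \<in> A \<Longrightarrow> open (chart_dom c)"
  using atlas by (auto simp: smooth_atlas_def)

lemma chart_homeomorphism:
  "c \<in> A \<Longrightarrow> homeomorphism (chart_dom c) (chart_cod c) (chart_map c) (chart_inv c)"
  using atlas by (auto simp: smooth_atlas_def)

lemma chart_inv_map: "c \<in> A \<Longrightarrow> p \<in> chart_dom c \<Longrightarrow> chart_inv c (chart_map c p) = p"
  using chart_homeomorphism homeomorphism_apply1 by blast

lemma chart_map_inv: "c \<in> A \<Longrightarrow> x \<in> chart_cod c \<Longrightarrow> chart_map c (chart_inv c x) = x"
  using chart_homeomorphism homeomorphism_apply2 by blast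

lemma chart_inv_in: "c \<in> A \<Longrightarrow> x \<in> chart_cod c \<Longrightarrow> chart_inv c x \<in> chart_dom c"
  using chart_homeomorphism homeomorphism_image2 by blast

lemma chart_inv_continuous: "c \<in> A \<Longrightarrow> continuous_on (chart_cod c) (chart_inv c)"
  using chart_homeomorphism homeomorphism_cont2 by blast

lemma chart_inv_charts_at: "c \<in> A \<Longrightarrow> x \<in> chart_cod c \<Longrightarrow> c \<in> charts_at A (chart_inv c x)"
  by (simp add: charts_at_def chart_inv_in)

lemma open_chart_preimage:
  assumes "c \<in> A" "continuous_on UNIV f" "open W"
  shows "open {x \<in> chart_cod c. f (chart_inv c x) \<in> W}"
proof -
  have "continuous_on (chart_cod c) (\<lambda>x. f (chart_inv c x))"
    using assms chart_inv_continuous by (intro continuous_on_compose2[OF assms(2)]) auto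
  then show ?thesis
    using continuous_open_preimage[OF _ chart_cod_open[OF assms(1)] assms(3)]
    by (simp add: vimage_def Int_def)
qed

lemma open_chart_overlap:
  "c \<in> A \<Longrightarrow> d \<in> A \<Longrightarrow> open {x \<in> chart_cod c. chart_inv c x \<in> chart_dom d}"
  using open_chart_preimage[of c "\<lambda>p. p" "chart_dom d"] by (simp add: chart_dom_open)

lemma transition_domain:
  "c \<in> A \<Longrightarrow> chart_map c ` (chart_dom c \<inter> chart_dom d) = {x \<in> chart_cod c. chart_inv c x \<in> chart_dom d}"
  by (auto simp: chart_inv_map chart_map_in chart_map_inv intro!: rev_image_eqI[OF IntI] chart_inv_in)

lemma Ck_on_transition:
  assumes "c \<in> A" "d \<in> A"
  shows "Ck_on k {x \<in> chart_cod c. chart_inv c x \<in> chart_dom d} (transition c d)"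
proof -
  have "C_on \<infinity> (chart_map c ` (chart_dom c \<inter> chart_dom d)) (transition c d)"
    using atlas assms unfolding smooth_atlas_def by blast
  then show ?thesis using assms by (simp add: transition_domain C_on_def)
qed

lemma transition_differentiable:
  assumes "c \<in> charts_at A p" "d \<in> charts_at A p"
  shows "transition c d differentiable (at (chart_map c p))"
proof (rule Ck_on_imp_differentiable)
  show "Ck_on (Suc 0) {x \<in> chart_cod c. chart_inv c x \<in> chart_dom d} (transition c d)"
    by (rule Ck_on_transition[OF assms[THEN charts_atD(1)]])
qed (use assms open_chart_overlap in \<open>auto simp: charts_at_def chart_map_in chart_inv_map\<close>)

lemma transition_chart_map:
  "c \<in> A \<Longrightarrow> p \<in> chart_dom c \<Longrightarrow> transition c d (chart_map c p) = chart_map d p"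
  by (simp add: transition_def chart_inv_map)

lemma transition_cocycle:
  assumes "c \<in> charts_at A p" "d \<in> charts_at A p" "e \<in> charts_at A p"
  shows "frechet_derivative (transition c e) (at (chart_map c p)) u
    = frechet_derivative (transition d e) (at (chart_map d p))
        (frechet_derivative (transition c d) (at (chart_map c p)) u)"
proof -
  have ch: "c \<in> A" "d \<in> A" "e \<in> A" "p \<in> chart_dom c" "p \<in> chart_dom d"
    using assms by (auto simp: charts_at_def)
  have tp: "transition c d (chart_map c p) = chart_map d p"
    using ch by (simp add: transition_chart_map)
  have "frechet_derivative (transition c e) (at (chart_map c p)) u
    = frechet_derivative (transition d e) (at (transition c d (chart_map c p)))
        (frechet_derivative (transition c d) (at (chart_map c p)) u)"
  proof (rule frechet_derivative_compose_open)
    show "open {x \<in> chart_cod c. chart_inv c x \<in> chart_dom d}" using open_chart_overlap ch by blast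
    show "transition c d differentiable (at (chart_map c p))"
      using assms transition_differentiable by blast
    show "transition d e differentiable (at (transition c d (chart_map c p)))"
      unfolding tp using assms transition_differentiable by blast
  qed (use ch in \<open>auto simp: transition_def chart_inv_map chart_map_in\<close>)
  then show ?thesis by (simp add: tp)
qed

lemma transition_self:
  assumes "c \<in> charts_at A p"
  shows "frechet_derivative (transition c c) (at (chart_map c p)) u = u"
proof -
  have ch: "c \<in> A" "p \<in> chart_dom c" using assms by (auto simp: charts_at_def)
  have "(transition c c has_derivative (\<lambda>u. u)) (at (chart_map c p))"
    by (rule has_derivative_transform_within_open[OF has_derivative_ident chart_cod_open[OF ch(1)]])
      (use ch in \<open>auto simp: transition_def chart_map_in chart_map_inv\<close>)
  then show ?thesis by (metis frechet_derivative_at)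
qed

lemma chart_vector_tangent:
  assumes "c \<in> charts_at A p"
  shows "chart_vector A c p u \<in> tangent_space A p"
  by (intro tangent_spaceI) (simp_all add: chart_vector_def transition_cocycle[OF assms, symmetric])

lemma chart_vector_self: "c \<in> charts_at A p \<Longrightarrow> chart_vector A c p u c = u"
  by (simp add: chart_vector_def transition_self)

lemma chart_vector_of_tangent:
  "c \<in> charts_at A p \<Longrightarrow> v \<in> tangent_space A p \<Longrightarrow> chart_vector A c p (v c) = v"
  unfolding chart_vector_def
  by (intro ext) (metis tangent_vector_transition tangent_vector_off_charts)

lemma tensor_eq_tensor_in_chart:
  assumes "c \<in> charts_at A p" "v \<in> tangent_space A p" "w \<in> tangent_space A p"
  shows "h p v w = tensor_in_chart A c h (chart_map c p) (v c) (w c)"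
  using assms by (simp add: tensor_in_chart_def chart_inv_map charts_atD chart_vector_of_tangent)

lemma C_map_preimage_open:
  "C_map A r f \<Longrightarrow> c \<in> A \<Longrightarrow> d \<in> A \<Longrightarrow> open {x \<in> chart_cod c. f (chart_inv c x) \<in> chart_dom d}"
  unfolding C_map_def using open_chart_preimage chart_dom_open by blast

lemma map_in_charts_differentiable:
  assumes "C_map A r f" "1 \<le> r" "c \<in> charts_at A p" "d \<in> charts_at A (f p)"
  shows "map_in_charts c d f differentiable (at (chart_map c p))"
proof (rule Ck_on_imp_differentiable)
  show "Ck_on (Suc 0) {x \<in> chart_cod c. f (chart_inv c x) \<in> chart_dom d} (map_in_charts c d f)"
    using C_map_Ck_on[OF assms(1) _ charts_atD(1)[OF assms(3)] charts_atD(1)[OF assms(4)], of "Suc 0"]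
      assms(2) by (simp add: one_enat_def)
qed (use assms C_map_preimage_open in \<open>auto simp: charts_at_def chart_map_in chart_inv_map\<close>)

lemma map_in_charts_chart_map:
  "c \<in> charts_at A p \<Longrightarrow> map_in_charts c d f (chart_map c p) = chart_map d (f p)"
  by (simp add: map_in_charts_def chart_inv_map charts_atD)

text \<open>The coordinate representations of a map in two charts differ by a transition map; the next two
  lemmas are the chain rule for a change of the chart in the source and in the target.\<close>

lemma map_in_charts_source_change:
  assumes "C_map A r f" "1 \<le> r" "c \<in> charts_at A p" "c' \<in> charts_at A p" "d \<in> charts_at A (f p)"
  shows "frechet_derivative (map_in_charts c d f) (at (chart_map c p)) u
    = frechet_derivative (map_in_charts c' d f) (at (chart_map c' p))
        (frechet_derivative (transition c c') (at (chart_map c p)) u)"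
proof -
  have ch: "c \<in> A" "c' \<in> A" "p \<in> chart_dom c" "p \<in> chart_dom c'"
    using assms by (auto simp: charts_at_def)
  have tp: "transition c c' (chart_map c p) = chart_map c' p"
    using ch by (simp add: transition_chart_map)
  have "frechet_derivative (map_in_charts c d f) (at (chart_map c p)) u
    = frechet_derivative (map_in_charts c' d f) (at (transition c c' (chart_map c p)))
        (frechet_derivative (transition c c') (at (chart_map c p)) u)"
  proof (rule frechet_derivative_compose_open)
    show "open {x \<in> chart_cod c. chart_inv c x \<in> chart_dom c'}" using open_chart_overlap ch by blast
    show "transition c c' differentiable (at (chart_map c p))"
      using assms transition_differentiable by blast
    show "map_in_charts c' d f differentiable (at (transition c c' (chart_map c p)))"
      unfolding tp using assms map_in_charts_differentiable by blast
  qed (use ch in \<open>auto simp: transition_def map_in_charts_def chart_inv_map chart_map_in\<close>)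
  then show ?thesis by (simp add: tp)
qed

lemma map_in_charts_target_change:
  assumes "C_map A r f" "1 \<le> r" "c \<in> charts_at A p" "d \<in> charts_at A (f p)" "d' \<in> charts_at A (f p)"
  shows "frechet_derivative (map_in_charts c d' f) (at (chart_map c p)) u
    = frechet_derivative (transition d d') (at (chart_map d (f p)))
        (frechet_derivative (map_in_charts c d f) (at (chart_map c p)) u)"
proof -
  have ch: "c \<in> A" "d \<in> A" "p \<in> chart_dom c" "f p \<in> chart_dom d"
    using assms by (auto simp: charts_at_def)
  have tp: "map_in_charts c d f (chart_map c p) = chart_map d (f p)"
    using assms by (simp add: map_in_charts_chart_map)
  have "frechet_derivative (map_in_charts c d' f) (at (chart_map c p)) u
    = frechet_derivative (transition d d') (at (map_in_charts c d f (chart_map c p)))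
        (frechet_derivative (map_in_charts c d f) (at (chart_map c p)) u)"
  proof (rule frechet_derivative_compose_open)
    show "open {x \<in> chart_cod c. f (chart_inv c x) \<in> chart_dom d}"
      using C_map_preimage_open assms ch by blast
    show "map_in_charts c d f differentiable (at (chart_map c p))"
      using assms map_in_charts_differentiable by blast
    show "transition d d' differentiable (at (map_in_charts c d f (chart_map c p)))"
      unfolding tp using assms transition_differentiable by blast
  qed (use ch in \<open>auto simp: transition_def map_in_charts_def chart_inv_map chart_map_in\<close>)
  then show ?thesis by (simp add: tp)
qed

text \<open>The definition of \<^const>\<open>differential\<close> uses one selected chart in the source. The transformation
  law of tangent vectors makes every other chart equally good.\<close>

lemma differential_in_charts:
  assumes "C_map A r f" "1 \<le> r" "c \<in> charts_at A p" "d \<in> charts_at A (f p)" "v \<in> tangent_space A p"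
  shows "differential A f p v d
    = frechet_derivative (map_in_charts c d f) (at (chart_map c p)) (v c)"
proof -
  let ?c = "chart_at A p"
  have "v c = frechet_derivative (transition ?c c) (at (chart_map ?c p)) (v ?c)"
    using tangent_vector_transition[OF assms(5) chart_at_in assms(3)] .
  then show ?thesis
    using map_in_charts_source_change[OF assms(1,2) chart_at_in assms(3,4)] assms(4)
    by (simp add: differential_def Let_def)
qed

lemma differential_tangent:
  assumes "C_map A r f" "1 \<le> r"
  shows "differential A f p v \<in> tangent_space A (f p)"
  by (intro tangent_spaceI)
    (simp_all add: differential_def Let_def
      map_in_charts_target_change[OF assms chart_at_in, symmetric])

text \<open>The chain rule for \<open>f \<circ> inv f\<close>, whose coordinate representation is the identity.\<close>

lemma differential_inv_in_charts:
  assumes f: "C_map A r f" "C_map A r (inv f)" "1 \<le> r" "bij f"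
    and c: "c \<in> charts_at A p" and d: "d \<in> charts_at A (f p)" and v: "v \<in> tangent_space A (f p)"
  shows "frechet_derivative (map_in_charts c d f) (at (chart_map c p))
    (differential A (inv f) (f p) v c) = v d"
proof -
  have ch: "c \<in> A" "d \<in> A" "p \<in> chart_dom c" "f p \<in> chart_dom d"
    using c d by (auto simp: charts_at_def)
  have invf: "inv f (f q) = q" "f (inv f q) = q" for q
    using \<open>bij f\<close> by (auto simp: bij_is_inj bij_is_surj surj_f_inv_f)
  have tp: "map_in_charts d c (inv f) (chart_map d (f p)) = chart_map c p"
    using d by (simp add: map_in_charts_chart_map invf)
  have "((\<lambda>x. x) has_derivative (\<lambda>u. frechet_derivative (map_in_charts c d f) (at (chart_map c p))
      (frechet_derivative (map_in_charts d c (inv f)) (at (chart_map d (f p))) u))) (at (chart_map d (f p)))"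
  proof (rule has_derivative_compose_open[where f = "map_in_charts d c (inv f)"
        and f' = "frechet_derivative (map_in_charts d c (inv f)) (at (chart_map d (f p)))"
        and g = "map_in_charts c d f"
        and g' = "frechet_derivative (map_in_charts c d f) (at (chart_map c p))"])
    show "open {x \<in> chart_cod d. inv f (chart_inv d x) \<in> chart_dom c}"
      using C_map_preimage_open f(2) ch by blast
    show "(map_in_charts d c (inv f) has_derivative
        frechet_derivative (map_in_charts d c (inv f)) (at (chart_map d (f p)))) (at (chart_map d (f p)))"
      using map_in_charts_differentiable[OF f(2,3) d] c
      by (intro frechet_derivative_worksI) (simp add: invf)
    show "(map_in_charts c d f has_derivative frechet_derivative (map_in_charts c d f) (at (chart_map c p)))
        (at (map_in_charts d c (inv f) (chart_map d (f p))))"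
      unfolding tp using map_in_charts_differentiable[OF f(1,3) c d]
      by (intro frechet_derivative_worksI)
  qed (use ch in \<open>auto simp: map_in_charts_def chart_inv_map chart_map_in chart_map_inv invf\<close>)
  moreover have "differential A (inv f) (f p) v c
      = frechet_derivative (map_in_charts d c (inv f)) (at (chart_map d (f p))) (v d)"
    using differential_in_charts[OF f(2,3) d _ v] c by (simp add: invf)
  ultimately show ?thesis
    using has_derivative_unique[OF _ has_derivative_ident] by metis
qed

end

section \<open>Tensor fields and Lie derivatives in charts\<close>

text \<open>The regularity of a function on the manifold has to be checked in every chart, whereas
  \<^const>\<open>lie_derivative\<close> refers to a selected one. This is its formula in an arbitrary chart.\<close>

definition lie_derivative_in_chart ::
    "('m, 'e::euclidean_space) chart set \<Rightarrow> ('m, 'e) chart \<Rightarrow> ('m, 'e) vfield \<Rightarrow> ('m, 'e) tensor2 \<Rightarrow>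
     'e \<Rightarrow> 'e \<Rightarrow> 'e \<Rightarrow> real" where
  "lie_derivative_in_chart A c X h x u w =
     frechet_derivative (\<lambda>y. tensor_in_chart A c h y u w) (at x) (field_in_chart c X x)
     + tensor_in_chart A c h x (frechet_derivative (field_in_chart c X) (at x) u) w
     + tensor_in_chart A c h x u (frechet_derivative (field_in_chart c X) (at x) w)"

lemma symmetric_tensor_bilinear:
  "symmetric_tensor_field A h \<Longrightarrow> c \<in> A \<Longrightarrow> x \<in> chart_cod c \<Longrightarrow> bilinear (tensor_in_chart A c h x)"
  by (simp add: symmetric_tensor_field_def)

lemma symmetric_tensor_Ck_on:
  "symmetric_tensor_field A h \<Longrightarrow> c \<in> A \<Longrightarrow> Ck_on k (chart_cod c) (\<lambda>x. tensor_in_chart A c h x u w)"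
  by (simp add: symmetric_tensor_field_def C_on_def)

context
  fixes A :: "('m::topological_space, 'e::euclidean_space) chart set"
  assumes atlas: "smooth_atlas A"
begin

lemma lie_derivative_eq_in_chart:
  "lie_derivative A X h p v w
    = lie_derivative_in_chart A (chart_at A p) X h (chart_map (chart_at A p) p)
        (v (chart_at A p)) (w (chart_at A p))"
  by (simp add: lie_derivative_def lie_derivative_in_chart_def Let_def)

text \<open>The derivatives of the components of \<open>h\<close> and \<open>X\<close> are of class \<open>C\<^sup>k\<close>. Expanding their vector arguments
  in a basis exhibits the Lie derivative as a polynomial in functions of class \<open>C\<^sup>k\<close>.\<close>

lemma Ck_on_lie_derivative_in_chart:
  assumes c: "c \<in> A" and h: "symmetric_tensor_field A h"
    and X: "Ck_on (Suc k) (chart_cod c) (field_in_chart c X)"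
  shows "Ck_on k (chart_cod c) (\<lambda>x. lie_derivative_in_chart A c X h x u w)"
proof -
  let ?U = "chart_cod c" and ?h = "tensor_in_chart A c h" and ?X = "field_in_chart c X"
  have op: "open ?U" using chart_cod_open[OF atlas c] .
  have hk: "Ck_on j ?U (\<lambda>x. ?h x u w)" for j u w using symmetric_tensor_Ck_on[OF h c] .
  have Dh: "(\<lambda>y. ?h y u w) differentiable (at x)" if "x \<in> ?U" for x
    using Ck_on_imp_differentiable[OF hk op that] .
  have Dhk: "Ck_on k ?U (\<lambda>x. frechet_derivative (\<lambda>y. ?h y u w) (at x) b)" for b
    using hk[of "Suc k" u w] op by (simp only: Ck_on_Suc_open)
  have DX: "Ck_on k ?U (\<lambda>x. frechet_derivative ?X (at x) u)" for u
    using X op by (simp only: Ck_on_Suc_open)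
  have Xk: "Ck_on k ?U ?X" using Ck_on_Suc_imp[OF X] .
  have "Ck_on k ?U (\<lambda>x. (\<Sum>b\<in>Basis. (?X x \<bullet> b) *\<^sub>R frechet_derivative (\<lambda>y. ?h y u w) (at x) b)
      + (\<Sum>b\<in>Basis. (frechet_derivative ?X (at x) u \<bullet> b) *\<^sub>R ?h x b w)
      + (\<Sum>b\<in>Basis. (frechet_derivative ?X (at x) w \<bullet> b) *\<^sub>R ?h x u b))"
    by (intro Ck_on_add Ck_on_sum Ck_on_scaleR Ck_on_inner Xk DX hk Dhk)
  moreover have "lie_derivative_in_chart A c X h x u w
      = (\<Sum>b\<in>Basis. (?X x \<bullet> b) *\<^sub>R frechet_derivative (\<lambda>y. ?h y u w) (at x) b)
      + (\<Sum>b\<in>Basis. (frechet_derivative ?X (at x) u \<bullet> b) *\<^sub>R ?h x b w)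
      + (\<Sum>b\<in>Basis. (frechet_derivative ?X (at x) w \<bullet> b) *\<^sub>R ?h x u b)" if x: "x \<in> ?U" for x
  proof -
    have bil: "bilinear (?h x)" using symmetric_tensor_bilinear[OF h c x] .
    then have l: "linear (\<lambda>a. ?h x a w)" "linear (?h x u)" by (simp_all add: bilinear_def)
    have lD: "linear (frechet_derivative (\<lambda>y. ?h y u w) (at x))"
      using Dh[OF x] by (rule linear_frechet_derivative)
    show ?thesis
      unfolding lie_derivative_in_chart_def
      by (simp only: flip: has_derivative_eq_sum_Basis[OF lD] has_derivative_eq_sum_Basis[OF l(1)]
          has_derivative_eq_sum_Basis[OF l(2)])
  qed
  ultimately show ?thesis by (simp cong: Ck_on_cong)
qed

lemma tensor_in_chart_pos:
  assumes h: "riemannian_metric A h" and c: "c \<in> A" "x \<in> chart_cod c" and u: "u \<noteq> 0"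
  shows "tensor_in_chart A c h x u u > 0"
proof -
  have ch: "c \<in> charts_at A (chart_inv c x)" using chart_inv_charts_at[OF atlas c] .
  have "chart_vector A c (chart_inv c x) u \<noteq> (\<lambda>_. 0)"
    using chart_vector_self[OF atlas ch, of u] u by metis
  then show ?thesis
    using h chart_vector_tangent[OF atlas ch]
    by (simp add: tensor_in_chart_def Let_def riemannian_metric_def)
qed

text \<open>Writing \<open>v\<close> in a second chart amounts to composing it with \<open>(s, y) \<mapsto> (s, \<tau> y)\<close> for the transition
  map \<open>\<tau>\<close>. The derivative of \<open>\<tau>\<close> transforms the coordinates of \<open>X\<close>, so \<open>\<partial>\<^sub>t v - X v\<close> is a number
  attached to the point.\<close>

lemma material_derivative_chart_independent:
  fixes v :: "real \<Rightarrow> 'm \<Rightarrow> real"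
  assumes t: "t \<in> I" "at t within I \<noteq> bot"
    and c: "c \<in> charts_at A p" "c' \<in> charts_at A p" and X: "X \<in> tangent_space A p"
    and D: "((\<lambda>(s, x). v s (chart_inv c x)) has_derivative D) (at (t, chart_map c p) within I \<times> chart_cod c)"
    and D': "((\<lambda>(s, x). v s (chart_inv c' x)) has_derivative D') (at (t, chart_map c' p) within I \<times> chart_cod c')"
  shows "D' (1, - X c') = D (1, - X c)"
proof -
  have ch: "c \<in> A" "c' \<in> A" "p \<in> chart_dom c" "p \<in> chart_dom c'" using c by (auto simp: charts_at_def)
  let ?\<tau> = "transition c' c" and ?x = "chart_map c' p"
  let ?d = "frechet_derivative ?\<tau> (at ?x)"
  define U where "U = {x \<in> chart_cod c'. chart_inv c' x \<in> chart_dom c}"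
  have U: "open U" "?x \<in> U"
    using open_chart_overlap[OF atlas ch(2,1)] ch
    by (simp_all add: U_def chart_map_in chart_inv_map[OF atlas])
  have \<tau>: "(?\<tau> has_derivative ?d) (at ?x)"
    using transition_differentiable[OF atlas c(2,1)] by (rule frechet_derivative_worksI)
  have \<tau>x: "?\<tau> ?x = chart_map c p" using transition_chart_map[OF atlas ch(2,4)] .
  have "((\<lambda>z. (fst z, ?\<tau> (snd z))) has_derivative (\<lambda>h. (fst h, ?d (snd h)))) (at (t, ?x) within I \<times> U)"
  proof (rule has_derivative_Pair[OF has_derivative_fst[OF has_derivative_ident]])
    have "(?\<tau> has_derivative ?d) (at (snd (t, ?x)))" using \<tau> by simp
    then show "((\<lambda>z. ?\<tau> (snd z)) has_derivative (\<lambda>h. ?d (snd h))) (at (t, ?x) within I \<times> U)"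
      by (rule has_derivative_compose[OF has_derivative_snd[OF has_derivative_ident]])
  qed
  moreover have "(\<lambda>z. (fst z, ?\<tau> (snd z))) ` (I \<times> U) \<subseteq> I \<times> chart_cod c"
    by (auto simp: U_def transition_def chart_map_in)
  then have "((\<lambda>(s, x). v s (chart_inv c x)) has_derivative D)
      (at ((\<lambda>z. (fst z, ?\<tau> (snd z))) (t, ?x)) within (\<lambda>z. (fst z, ?\<tau> (snd z))) ` (I \<times> U))"
    using has_derivative_subset[OF D] by (simp add: \<tau>x)
  ultimately have "((\<lambda>z. (\<lambda>(s, x). v s (chart_inv c x)) (fst z, ?\<tau> (snd z))) has_derivative
      (\<lambda>h. D (fst h, ?d (snd h)))) (at (t, ?x) within I \<times> U)"
    by (rule has_derivative_in_compose)
  then have 1: "((\<lambda>(s, x). v s (chart_inv c' x)) has_derivative (\<lambda>h. D (fst h, ?d (snd h)))) (at (t, ?x) within I \<times> U)"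
    by (rule has_derivative_transform[rotated 2])
      (use U(2) t(1) ch in \<open>auto simp: U_def transition_def chart_inv_map[OF atlas]\<close>)
  have 2: "((\<lambda>(s, x). v s (chart_inv c' x)) has_derivative D') (at (t, ?x) within I \<times> U)"
    by (rule has_derivative_subset[OF D']) (auto simp: U_def)
  have eq: "I \<times> U = (I \<times> UNIV) \<inter> (UNIV \<times> U)" by auto
  have "D' = (\<lambda>h. D (fst h, ?d (snd h)))"
    by (rule has_derivative_strip_unique[OF 2[unfolded eq] 1[unfolded eq]])
      (use U t in \<open>auto intro!: open_Times\<close>)
  then have "D' (1, - X c') = D (1, ?d (- X c'))" by simp
  also have "?d (- X c') = - X c"
    using linear_neg[OF has_derivative_linear[OF \<tau>]] tangent_vector_transition[OF X c(2,1)]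
    by simp
  finally show ?thesis .
qed

end

section \<open>The velocity field of a family of diffeomorphisms\<close>

definition family_domain ::
    "real set \<Rightarrow> (real \<Rightarrow> 'm \<Rightarrow> 'm) \<Rightarrow> ('m, 'e) chart \<Rightarrow> ('m, 'e) chart \<Rightarrow> (real \<times> 'e) set" where
  "family_domain I F c d = {(s, x). s \<in> I \<and> x \<in> chart_cod c \<and> F s (chart_inv c x) \<in> chart_dom d}"

text \<open>The tangent vector at \<open>F t p\<close> of the curve \<open>s \<mapsto> F s p\<close> at time \<open>t\<close>; the derivative is one-sided
  at an end point of the interval.\<close>

definition velocity ::
    "('m, 'e::euclidean_space) chart set \<Rightarrow> real set \<Rightarrow> (real \<Rightarrow> 'm \<Rightarrow> 'm) \<Rightarrow> real \<Rightarrow> 'm \<Rightarrow> ('m, 'e) tvec" where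
  "velocity A I F t p =
     (\<lambda>d. if d \<in> charts_at A (F t p)
          then vector_derivative (\<lambda>s. chart_map d (F s p)) (at t within I) else 0)"

text \<open>The vector field \<open>X\<close> with \<open>\<partial>\<^sub>t (F\<^sub>t\<^sup>* h) = L\<^sub>X (F\<^sub>t\<^sup>* h)\<close>: the velocity of the family is a field along
  \<open>F t\<close>, and the inverse of the differential of \<open>F t\<close> turns it into a field on the manifold.\<close>

definition pulled_back_velocity ::
    "('m, 'e::euclidean_space) chart set \<Rightarrow> real set \<Rightarrow> (real \<Rightarrow> 'm \<Rightarrow> 'm) \<Rightarrow> real \<Rightarrow> ('m, 'e) vfield" where
  "pulled_back_velocity A I F t p = differential A (inv (F t)) (F t p) (velocity A I F t p)"

context
  fixes A :: "('m::topological_space, 'e::euclidean_space) chart set"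
  assumes atlas: "smooth_atlas A"
begin

lemma family_domain_strip:
  assumes F: "C_map_family A r I F" and c: "c \<in> A" "d \<in> A"
  obtains W where "open W" "family_domain I F c d = (I \<times> UNIV) \<inter> W"
proof -
  have "continuous_on (I \<times> chart_cod c) (\<lambda>z. (\<lambda>(s, p). F s p) (fst z, chart_inv c (snd z)))"
  proof (rule continuous_on_compose2[where g = "\<lambda>(s, p). F s p" and t = "I \<times> UNIV"
        and f = "\<lambda>z. (fst z, chart_inv c (snd z))"])
    show "continuous_on (I \<times> UNIV) (\<lambda>(s, p). F s p)" using F by (simp add: C_map_family_def)
    show "continuous_on (I \<times> chart_cod c) (\<lambda>z. (fst z, chart_inv c (snd z)))"
      by (intro continuous_intros continuous_on_compose2[OF chart_inv_continuous[OF atlas c(1)]]) auto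
  qed auto
  then obtain B where B: "open B"
    "B \<inter> (I \<times> chart_cod c) = (\<lambda>z. (\<lambda>(s, p). F s p) (fst z, chart_inv c (snd z))) -` chart_dom d \<inter> (I \<times> chart_cod c)"
    using chart_dom_open[OF atlas c(2)] unfolding continuous_on_open_invariant by blast
  show thesis
  proof (rule that[of "B \<inter> (UNIV \<times> chart_cod c)"])
    show "open (B \<inter> (UNIV \<times> chart_cod c))"
      using B(1) chart_cod_open[OF atlas c(1)] by (intro open_Int open_Times) auto
    show "family_domain I F c d = (I \<times> UNIV) \<inter> (B \<inter> (UNIV \<times> chart_cod c))"
      using B(2) unfolding family_domain_def by (auto simp: set_eq_iff)
  qed
qed

lemma family_derivative:
  assumes "C_map_family A r I F" "enat (Suc k) \<le> r" "c \<in> A" "d \<in> A"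
  shows "\<exists>f'. (\<forall>z\<in>family_domain I F c d. ((\<lambda>(s, x). map_in_charts c d (F s) x) has_derivative f' z)
      (at z within family_domain I F c d)) \<and> (\<forall>u. Ck_on k (family_domain I F c d) (\<lambda>z. f' z u))"
proof -
  have "Ck_on (Suc k) (family_domain I F c d) (\<lambda>(s, x). map_in_charts c d (F s) x)"
    using assms unfolding C_map_family_def C_on_def family_domain_def by blast
  then show ?thesis unfolding Ck_on.simps .
qed

lemma family_spatial_derivative:
  assumes F: "C_map_family A r I F" and c: "c \<in> A" "d \<in> A"
    and z: "(s, x) \<in> family_domain I F c d"
    and f': "((\<lambda>(s, x). map_in_charts c d (F s) x) has_derivative f') (at (s, x) within family_domain I F c d)"
  shows "(map_in_charts c d (F s) has_derivative (\<lambda>u. f' (0, u))) (at x)"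
proof -
  obtain W where W: "open W" "family_domain I F c d = (I \<times> UNIV) \<inter> W"
    using family_domain_strip[OF F c] .
  show ?thesis
    using has_derivative_space_slice[OF f'[unfolded W(2)] W(1)] z W(2) by simp
qed

lemma velocity_in_charts:
  assumes F: "C_map_family A r I F" and c: "c \<in> A" "d \<in> A" and I: "at t within I \<noteq> bot"
    and z: "(t, x) \<in> family_domain I F c d"
    and f': "((\<lambda>(s, x). map_in_charts c d (F s) x) has_derivative f') (at (t, x) within family_domain I F c d)"
  shows "((\<lambda>s. chart_map d (F s (chart_inv c x))) has_vector_derivative f' (1, 0)) (at t within I)"
    and "velocity A I F t (chart_inv c x) d = f' (1, 0)"
proof -
  obtain W where W: "open W" "family_domain I F c d = (I \<times> UNIV) \<inter> W"
    using family_domain_strip[OF F c] .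
  show 1: "((\<lambda>s. chart_map d (F s (chart_inv c x))) has_vector_derivative f' (1, 0)) (at t within I)"
    using has_derivative_time_slice[OF f'[unfolded W(2)] W(1)] z W(2) by (simp add: map_in_charts_def)
  have "d \<in> charts_at A (F t (chart_inv c x))" using z c by (simp add: family_domain_def charts_at_def)
  then show "velocity A I F t (chart_inv c x) d = f' (1, 0)"
    using vector_derivative_within[OF I 1] by (simp add: velocity_def)
qed

text \<open>The curves \<open>s \<mapsto> F s p\<close> in two charts differ by a transition map for \<open>s\<close> near \<open>t\<close>, and the chain
  rule, for derivatives within the interval, is the transformation law of tangent vectors.\<close>

lemma velocity_tangent:
  assumes F: "C_map_family A r I F" "1 \<le> r" and t: "t \<in> I" "at t within I \<noteq> bot"
  shows "velocity A I F t p \<in> tangent_space A (F t p)"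
proof (rule tangent_spaceI)
  fix d d' assume d: "d \<in> charts_at A (F t p)" "d' \<in> charts_at A (F t p)"
  obtain c where c: "c \<in> charts_at A p" using charts_at_ex[OF atlas] by blast
  have ch: "c \<in> A" "d \<in> A" "p \<in> chart_dom c" "F t p \<in> chart_dom d" using c d by (auto simp: charts_at_def)
  let ?x = "chart_map c p"
  have p: "chart_inv c ?x = p" using chart_inv_map[OF atlas] ch by blast
  have z: "(t, ?x) \<in> family_domain I F c d" using ch t p chart_map_in by (simp add: family_domain_def)
  obtain f' where f': "((\<lambda>(s, x). map_in_charts c d (F s) x) has_derivative f') (at (t, ?x) within family_domain I F c d)"
    using family_derivative[OF F(1) _ ch(1,2), of 0] F(2) z by (auto simp: one_enat_def)
  let ?\<tau> = "frechet_derivative (transition d d') (at (chart_map d (F t p)))"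
  have \<tau>: "(transition d d' has_derivative ?\<tau>) (at (chart_map d (F t p)))"
    using transition_differentiable[OF atlas d] by (rule frechet_derivative_worksI)
  obtain W where W: "open W" "family_domain I F c d = (I \<times> UNIV) \<inter> W"
    using family_domain_strip[OF F(1) ch(1,2)] .
  define J where "J = {s. (s, ?x) \<in> W}"
  have J: "open J" "t \<in> J"
    using open_vimage[OF W(1), of "\<lambda>s. (s, ?x)"] z W(2) by (auto simp: J_def vimage_def continuous_intros)
  have J_dom: "F s p \<in> chart_dom d" if "s \<in> I \<inter> J" for s
  proof -
    have "(s, ?x) \<in> family_domain I F c d" using that W(2) by (simp add: J_def)
    then show ?thesis by (simp add: family_domain_def p)
  qed
  have v: "velocity A I F t p d = f' (1, 0)"
    using velocity_in_charts(2)[OF F(1) ch(1,2) t(2) z f'] p by simp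
  have "((\<lambda>s. chart_map d (F s p)) has_derivative (\<lambda>h. h *\<^sub>R f' (1, 0))) (at t within I \<inter> J)"
    using velocity_in_charts(1)[OF F(1) ch(1,2) t(2) z f'] p at_within_Int_open[OF J, of I]
    by (simp add: has_vector_derivative_def)
  then have "((\<lambda>s. transition d d' (chart_map d (F s p))) has_derivative (\<lambda>h. ?\<tau> (h *\<^sub>R f' (1, 0))))
      (at t within I \<inter> J)"
    using has_derivative_compose[of "\<lambda>s. chart_map d (F s p)" _ t "I \<inter> J" "transition d d'" ?\<tau>] \<tau>
    by blast
  then have "((\<lambda>s. chart_map d' (F s p)) has_derivative (\<lambda>h. ?\<tau> (h *\<^sub>R f' (1, 0)))) (at t within I \<inter> J)"
    by (rule has_derivative_transform[rotated 2])
      (use J t J_dom in \<open>auto simp: transition_chart_map[OF atlas ch(2)]\<close>)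
  then have "((\<lambda>s. chart_map d' (F s p)) has_vector_derivative ?\<tau> (f' (1, 0))) (at t within I)"
    using linear_scale[OF has_derivative_linear[OF \<tau>]] at_within_Int_open[OF J, of I]
    by (simp add: has_vector_derivative_def)
  then have "velocity A I F t p d' = ?\<tau> (f' (1, 0))"
    using vector_derivative_within[OF t(2)] d(2) by (simp add: velocity_def)
  then show "velocity A I F t p d' = ?\<tau> (velocity A I F t p d)" using v by simp
qed (simp add: velocity_def)

text \<open>The assumption on \<open>t'\<close> says that the interval is nondegenerate, which makes derivatives in time
  unique.\<close>

context
  fixes I :: "real set" and F :: "real \<Rightarrow> 'm \<Rightarrow> 'm" and r :: enat and t t' :: real
  assumes F: "C_map_family A r I F" and r: "2 \<le> r"
    and diffeo: "\<And>s. s \<in> I \<Longrightarrow> C_diffeomorphism A r (F s)"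
    and I: "is_interval I" "t \<in> I" "t' \<in> I" "t \<noteq> t'"
begin

lemma at_t_nontrivial: "at t within I \<noteq> bot"
  using interval_at_within_nontrivial I by blast

lemma one_le_r: "1 \<le> r"
  using r order_trans[of 1 "2::enat" r] by simp

lemma diffeoD:
  assumes "s \<in> I"
  shows "bij (F s)" "C_map A r (F s)" "C_map A r (inv (F s))"
  using diffeo[OF assms] by (auto simp: C_diffeomorphism_def)

lemma inv_F: "inv (F t) (F t p) = p"
  using diffeoD(1)[OF I(2)] by (simp add: bij_is_inj)

lemma pulled_back_velocity_tangent: "pulled_back_velocity A I F t p \<in> tangent_space A p"
  using differential_tangent[OF atlas diffeoD(3)[OF I(2)] one_le_r, of "F t p"]
  by (simp add: pulled_back_velocity_def inv_F)

text \<open>The inverse of the differential of \<open>F t\<close> is the differential of the inverse map, which has by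
  hypothesis the same regularity as \<open>F t\<close>. In charts the field is therefore the derivative of the
  inverse map at \<open>F t\<close>, applied to the time derivative of the family: one derivative is lost.\<close>

lemma Ck_on_pulled_back_velocity:
  assumes k: "enat (Suc k) \<le> r" and c: "c \<in> A"
  shows "Ck_on k (chart_cod c) (field_in_chart c (pulled_back_velocity A I F t))"
proof (rule Ck_on_local[OF chart_cod_open[OF atlas c]])
  fix x0 assume x0: "x0 \<in> chart_cod c"
  obtain d where d: "d \<in> charts_at A (F t (chart_inv c x0))" using charts_at_ex[OF atlas] by blast
  have dA: "d \<in> A" using d by (simp add: charts_at_def)
  define U where "U = {x \<in> chart_cod c. F t (chart_inv c x) \<in> chart_dom d}"
  define V where "V = {y \<in> chart_cod d. inv (F t) (chart_inv d y) \<in> chart_dom c}"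
  let ?\<Phi> = "map_in_charts c d (F t)" and ?\<Psi> = "map_in_charts d c (inv (F t))"
  have U: "open U" "x0 \<in> U" "U \<subseteq> chart_cod c"
    using C_map_preimage_open[OF atlas diffeoD(2)[OF I(2)] c dA] x0 d
    by (auto simp: U_def charts_at_def)
  have V: "open V" using C_map_preimage_open[OF atlas diffeoD(3)[OF I(2)] dA c] by (simp add: V_def)
  have \<Phi>V: "?\<Phi> ` U \<subseteq> V"
    by (auto simp: U_def V_def map_in_charts_def inv_F chart_map_in chart_inv_map[OF atlas dA]
        chart_inv_in[OF atlas c])
  have \<Phi>: "Ck_on k U ?\<Phi>"
    using C_map_Ck_on[OF diffeoD(2)[OF I(2)] k c dA] Ck_on_Suc_imp by (simp only: U_def)
  have "Ck_on (Suc k) V ?\<Psi>"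
    using C_map_Ck_on[OF diffeoD(3)[OF I(2)] k dA c] by (simp only: V_def)
  then have D\<Psi>: "?\<Psi> differentiable (at y)" "Ck_on k V (\<lambda>y. frechet_derivative ?\<Psi> (at y) b)" if "y \<in> V" for y b
    using that V by (simp_all only: Ck_on_Suc_open)
  obtain f' where f': "\<forall>z\<in>family_domain I F c d. ((\<lambda>(s, x). map_in_charts c d (F s) x) has_derivative f' z)
      (at z within family_domain I F c d)" "\<forall>u. Ck_on k (family_domain I F c d) (\<lambda>z. f' z u)"
    using family_derivative[OF F k c dA] by blast
  have US: "(t, x) \<in> family_domain I F c d" if "x \<in> U" for x
    using that I by (simp add: U_def family_domain_def)
  have vel: "Ck_on k U (\<lambda>x. f' (t, x) (1, 0))"
    using US by (intro Ck_on_compose[OF f'(2)[rule_format] Ck_on_Pair_const]) auto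
  have "Ck_on k U (\<lambda>x. \<Sum>b\<in>Basis. (f' (t, x) (1, 0) \<bullet> b) *\<^sub>R frechet_derivative ?\<Psi> (at (?\<Phi> x)) b)"
    using U(2) \<Phi>V
    by (intro Ck_on_sum Ck_on_scaleR Ck_on_inner vel Ck_on_compose[OF D\<Psi>(2) \<Phi> \<Phi>V]) auto
  moreover have "field_in_chart c (pulled_back_velocity A I F t) x
      = (\<Sum>b\<in>Basis. (f' (t, x) (1, 0) \<bullet> b) *\<^sub>R frechet_derivative ?\<Psi> (at (?\<Phi> x)) b)" if x: "x \<in> U" for x
  proof -
    let ?p = "chart_inv c x"
    have ch: "d \<in> charts_at A (F t ?p)" "c \<in> charts_at A ?p"
      using x dA chart_inv_charts_at[OF atlas c] by (auto simp: U_def charts_at_def)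
    have "field_in_chart c (pulled_back_velocity A I F t) x
        = frechet_derivative ?\<Psi> (at (chart_map d (F t ?p))) (velocity A I F t ?p d)"
      unfolding field_in_chart_def pulled_back_velocity_def
      using ch by (intro differential_in_charts[OF atlas diffeoD(3)[OF I(2)] one_le_r]
          velocity_tangent[OF F one_le_r I(2) at_t_nontrivial]) (auto simp: inv_F)
    also have "velocity A I F t ?p d = f' (t, x) (1, 0)"
      using velocity_in_charts(2)[OF F c dA at_t_nontrivial US[OF x]] f'(1) US[OF x] by blast
    also have "chart_map d (F t ?p) = ?\<Phi> x" by (simp add: map_in_charts_def)
    also have "frechet_derivative ?\<Psi> (at (?\<Phi> x)) (f' (t, x) (1, 0))
        = (\<Sum>b\<in>Basis. (f' (t, x) (1, 0) \<bullet> b) *\<^sub>R frechet_derivative ?\<Psi> (at (?\<Phi> x)) b)"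
      using D\<Psi>(1) \<Phi>V x by (intro has_derivative_eq_sum_Basis linear_frechet_derivative) auto
    finally show ?thesis .
  qed
  ultimately have "Ck_on k U (field_in_chart c (pulled_back_velocity A I F t))" by (simp cong: Ck_on_cong)
  with U show "\<exists>U. open U \<and> x0 \<in> U \<and> U \<subseteq> chart_cod c \<and>
      Ck_on k U (field_in_chart c (pulled_back_velocity A I F t))" by blast
qed

text \<open>With \<open>X\<close> the pulled-back velocity, this is
  \<open>L\<^sub>X g = \<partial>\<^sub>t g - ((\<partial>\<^sub>t v - X v) / v) g\<close>. In a chart \<open>c\<close> at \<open>p\<close> and a chart \<open>d\<close> at \<open>F t p\<close> it is the
  coordinate computation \<open>conformal_pullback_time_derivative\<close> with \<open>f s = d \<circ> F s \<circ> c\<^sup>-\<^sup>1\<close>.\<close>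

lemma lie_derivative_of_conformal_pullback_family:
  assumes h: "symmetric_tensor_field A h"
    and v: "v t p \<noteq> 0"
    and g: "\<And>s p a b. s \<in> I \<Longrightarrow> a \<in> tangent_space A p \<Longrightarrow> b \<in> tangent_space A p \<Longrightarrow>
        g s p a b = v s p * pullback A (F s) h p a b"
    and Q: "\<And>a b. a \<in> tangent_space A p \<Longrightarrow> b \<in> tangent_space A p \<Longrightarrow>
        ((\<lambda>s. g s p a b) has_real_derivative Q p a b) (at t within I)"
    and c: "c \<in> charts_at A p"
    and D: "((\<lambda>(s, x). v s (chart_inv c x)) has_derivative D) (at (t, chart_map c p) within I \<times> chart_cod c)"
  shows "lie_derivative_in_chart A c (pulled_back_velocity A I F t) (g t) (chart_map c p) u w
    = tensor_in_chart A c Q (chart_map c p) u w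
      - D (1, - pulled_back_velocity A I F t p c) / v t p * tensor_in_chart A c (g t) (chart_map c p) u w"
proof -
  let ?X = "pulled_back_velocity A I F t" and ?x = "chart_map c p"
  obtain d where d: "d \<in> charts_at A (F t p)" using charts_at_ex[OF atlas] by blast
  have ch: "c \<in> A" "d \<in> A" "p \<in> chart_dom c" "F t p \<in> chart_dom d" using c d by (auto simp: charts_at_def)
  have p: "chart_inv c ?x = p" using chart_inv_map[OF atlas] ch by blast
  define S where "S = family_domain I F c d"
  obtain W where W: "open W" "S = (I \<times> UNIV) \<inter> W"
    using family_domain_strip[OF F ch(1,2)] unfolding S_def .
  have z: "(t, ?x) \<in> S" using ch I p chart_map_in by (simp add: S_def family_domain_def)
  have "enat (Suc (Suc 0)) \<le> r" using r by (simp add: numeral_2_eq_2 enat_numeral[symmetric] del: enat_numeral)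
  then obtain f' where f'1: "\<forall>z\<in>S. ((\<lambda>(s, x). map_in_charts c d (F s) x) has_derivative f' z) (at z within S)"
    and f'2: "\<forall>u. Ck_on (Suc 0) S (\<lambda>z. f' z u)"
    using family_derivative[OF F _ ch(1,2), of "Suc 0"] unfolding S_def by blast
  have spatial: "frechet_derivative (map_in_charts c d (F s)) (at y) u = f' (s, y) (0, u)"
    if "(s, y) \<in> S" for s y u
    using family_spatial_derivative[OF F ch(1,2)] f'1 that frechet_derivative_at unfolding S_def by metis
  have S_charts: "s \<in> I" "y \<in> chart_cod c" "c \<in> charts_at A (chart_inv c y)"
    "d \<in> charts_at A (F s (chart_inv c y))" "chart_map c (chart_inv c y) = y" if "(s, y) \<in> S" for s y
    using that ch chart_inv_charts_at[OF atlas ch(1)] chart_map_inv[OF atlas ch(1)]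
    by (auto simp: S_def family_domain_def charts_at_def)
  have X_differentiable: "field_in_chart c ?X differentiable (at ?x)"
    using Ck_on_imp_differentiable[OF Ck_on_pulled_back_velocity[OF \<open>enat (Suc (Suc 0)) \<le> r\<close> ch(1)]
        chart_cod_open[OF atlas ch(1)]] chart_map_in[OF ch(3)] by blast
  \<comment> \<open>The differential of \<open>F t\<close> maps the pulled-back velocity back to the velocity.\<close>
  have transport: "f' (t, y) (1, 0) = f' (t, y) (0, field_in_chart c ?X y)" if y: "(t, y) \<in> S" for y
  proof -
    let ?q = "chart_inv c y"
    have "frechet_derivative (map_in_charts c d (F t)) (at (chart_map c ?q)) (?X ?q c) = velocity A I F t ?q d"
      unfolding pulled_back_velocity_def
      by (rule differential_inv_in_charts[OF atlas diffeoD(2,3)[OF I(2)] one_le_r diffeoD(1)[OF I(2)]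
            S_charts(3,4)[OF y] velocity_tangent[OF F one_le_r I(2) at_t_nontrivial]])
    moreover have "velocity A I F t ?q d = f' (t, y) (1, 0)"
      using velocity_in_charts(2)[OF F ch(1,2) at_t_nontrivial y[unfolded S_def]] f'1 y
      unfolding S_def by blast
    ultimately show ?thesis
      using spatial[OF y] S_charts(5)[OF y] by (simp add: field_in_chart_def)
  qed
  have G: "tensor_in_chart A c (g (fst z)) (snd z) u w
      = (\<lambda>(s, x). v s (chart_inv c x)) z * tensor_in_chart A d h ((\<lambda>(s, x). map_in_charts c d (F s) x) z)
          (f' z (0, u)) (f' z (0, w))" if "z \<in> S" for z u w
  proof -
    obtain s y where z: "z = (s, y)" by (cases z)
    have sy: "(s, y) \<in> S" using that z by simp
    let ?q = "chart_inv c y"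
    let ?a = "chart_vector A c ?q u" and ?b = "chart_vector A c ?q w"
    note sc = S_charts[OF sy]
    have diff: "differential A (F s) ?q (chart_vector A c ?q u) d = f' (s, y) (0, u)" for u
      using differential_in_charts[OF atlas diffeoD(2)[OF sc(1)] one_le_r sc(3,4) chart_vector_tangent[OF atlas sc(3)]]
        chart_vector_self[OF atlas sc(3)] spatial[OF sy] sc(5) by simp
    have "tensor_in_chart A c (g s) y u w = v s ?q * h (F s ?q) (differential A (F s) ?q ?a) (differential A (F s) ?q ?b)"
      using g[OF sc(1) chart_vector_tangent[OF atlas sc(3)] chart_vector_tangent[OF atlas sc(3)]]
      by (simp add: tensor_in_chart_def Let_def pullback_def)
    also have "h (F s ?q) (differential A (F s) ?q ?a) (differential A (F s) ?q ?b)
        = tensor_in_chart A d h (chart_map d (F s ?q)) (f' (s, y) (0, u)) (f' (s, y) (0, w))"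
      by (simp add: diff tensor_eq_tensor_in_chart[where h = h, OF atlas sc(4)
          differential_tangent[OF atlas diffeoD(2)[OF sc(1)] one_le_r]
          differential_tangent[OF atlas diffeoD(2)[OF sc(1)] one_le_r]])
    finally show ?thesis by (simp add: z map_in_charts_def)
  qed
  obtain \<sigma> where \<sigma>: "\<sigma> \<noteq> 0" "\<And>h. 0 \<le> h \<Longrightarrow> h \<le> 1 \<Longrightarrow> t + h * \<sigma> \<in> I"
    using interval_inward_direction[OF I] by blast
  have cv: "chart_vector A c p u \<in> tangent_space A p" for u using chart_vector_tangent[OF atlas c] .
  have "frechet_derivative (\<lambda>y. (\<lambda>z. tensor_in_chart A c (g (fst z)) (snd z)) (t, y) u w) (at ?x) (field_in_chart c ?X ?x)
      + (\<lambda>z. tensor_in_chart A c (g (fst z)) (snd z)) (t, ?x) (frechet_derivative (field_in_chart c ?X) (at ?x) u) w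
      + (\<lambda>z. tensor_in_chart A c (g (fst z)) (snd z)) (t, ?x) u (frechet_derivative (field_in_chart c ?X) (at ?x) w)
    = tensor_in_chart A c Q ?x u w
      - D (1, - field_in_chart c ?X ?x) / (\<lambda>(s, x). v s (chart_inv c x)) (t, ?x)
        * (\<lambda>z. tensor_in_chart A c (g (fst z)) (snd z)) (t, ?x) u w"
  proof (rule conformal_pullback_time_derivative[where S = S and W = W and I = I and \<sigma> = \<sigma>
        and f = "\<lambda>(s, x). map_in_charts c d (F s) x" and f' = f' and T = "chart_cod d"
        and \<gamma> = "tensor_in_chart A d h"])
    show "(field_in_chart c ?X has_derivative frechet_derivative (field_in_chart c ?X) (at ?x)) (at ?x)"
      using X_differentiable by (rule frechet_derivative_worksI)
    show "(\<lambda>y. tensor_in_chart A d h y u w) differentiable (at y)" if "y \<in> chart_cod d" for y u w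
      using Ck_on_imp_differentiable[OF symmetric_tensor_Ck_on[OF h ch(2)] chart_cod_open[OF atlas ch(2)] that] .
    show "bilinear (tensor_in_chart A d h y)" if "y \<in> chart_cod d" for y
      using symmetric_tensor_bilinear[OF h ch(2) that] .
    show "(\<lambda>(s, x). map_in_charts c d (F s) x) ` S \<subseteq> chart_cod d"
      by (auto simp: S_def family_domain_def map_in_charts_def chart_map_in)
    show "((\<lambda>(s, x). v s (chart_inv c x)) has_derivative D) (at (t, ?x) within S)"
      by (rule has_derivative_subset[OF D]) (auto simp: S_def family_domain_def)
    show "((\<lambda>s. (\<lambda>z. tensor_in_chart A c (g (fst z)) (snd z)) (s, ?x) u w) has_real_derivative
        tensor_in_chart A c Q ?x u w) (at t within I)"
      using Q[OF cv cv] by (simp add: tensor_in_chart_def Let_def p)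
  qed (use W z I f'1 f'2 transport G \<sigma> at_t_nontrivial v p in auto)
  then show ?thesis by (simp add: lie_derivative_in_chart_def field_in_chart_def p)
qed

end

end

section \<open>The soliton equation\<close>

theorem proposition2p1:
  fixes A :: "('m::{t2_space, second_countable_topology}, 'e::euclidean_space) chart set"
    and q :: "('m, 'e) tensor2 \<Rightarrow> ('m, 'e) tensor2"
    and I :: "real set"
    and g :: "real \<Rightarrow> ('m, 'e) tensor2"
    and r :: enat
  assumes "smooth_atlas A"
    and "\<And>h. riemannian_metric A h \<Longrightarrow> symmetric_tensor_field A (q h)"
    and "is_interval I" and "0 \<in> I" and "I \<noteq> {0}"
    and "smooth_metric_family A I g"
    and "solves_flow A q I g"
    and "fixed_up_to_conformal_diffeomorphism A (r + 2) I g"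
  shows "\<forall>t\<in>I. extended_soliton A r (q (g t)) (g t)"
proof
  fix t assume t: "t \<in> I"
  obtain v F where v: "\<forall>t\<in>I. \<forall>p. v t p > 0" and v_diff: "differentiable_function_family A I v"
    and diffeo: "\<forall>t\<in>I. C_diffeomorphism A (r + 2) (F t)" and F: "C_map_family A (r + 2) I F"
    and g: "\<forall>t\<in>I. \<forall>p. \<forall>a\<in>tangent_space A p. \<forall>b\<in>tangent_space A p.
           g t p a b = v t p * pullback A (F t) (g 0) p a b"
    using assms(8) unfolding fixed_up_to_conformal_diffeomorphism_def by blast
  have metric: "riemannian_metric A (g s)" if "s \<in> I" for s
    using assms(6) that by (simp add: smooth_metric_family_def)
  then have g_sym: "symmetric_tensor_field A (g s)" if "s \<in> I" for s
    using that by (simp add: riemannian_metric_def)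
  have q_sym: "symmetric_tensor_field A (q (g t))" using assms(2) metric t by blast
  obtain t' where t': "t' \<in> I" "t \<noteq> t'" using assms(4,5) by auto
  have two: "2 \<le> r + 2" by simp
  note fam = assms(1) F two diffeo[rule_format] assms(3) t t'
  have bot: "at t within I \<noteq> bot" using interval_at_within_nontrivial[OF assms(3) t t'] .
  define X where "X = pulled_back_velocity A I F t"
  have X_tangent: "X p \<in> tangent_space A p" for p
    unfolding X_def by (rule pulled_back_velocity_tangent[OF fam])
  have X_Ck: "Ck_on k (chart_cod c) (field_in_chart c X)" if "enat k \<le> r + 1" "c \<in> A" for k c
  proof -
    have "enat (Suc k) \<le> r + 2"
      using that(1) by (cases r) (auto simp: one_enat_def numeral_eq_enat)
    then show ?thesis unfolding X_def using Ck_on_pulled_back_velocity[OF fam] that(2) by blast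
  qed
  define Dv :: "('m, 'e) chart \<Rightarrow> 'm \<Rightarrow> real \<times> 'e \<Rightarrow> real" where "Dv c p = frechet_derivative (\<lambda>(s, x). v s (chart_inv c x))
      (at (t, chart_map c p) within I \<times> chart_cod c)" for c p
  have Dv: "((\<lambda>(s, x). v s (chart_inv c x)) has_derivative Dv c p)
      (at (t, chart_map c p) within I \<times> chart_cod c)" if "c \<in> charts_at A p" for c p
  proof -
    have "c \<in> A" "(t, chart_map c p) \<in> I \<times> chart_cod c"
      using that t by (simp_all add: charts_at_def chart_map_in)
    then show ?thesis
      using v_diff unfolding Dv_def differentiable_function_family_def differentiable_on_def
      by (intro frechet_derivative_worksI) blast
  qed
  \<comment> \<open>Half of \<open>(X v - \<partial>\<^sub>t v) / v\<close>, the factor that \<open>L\<^sub>X g = q (g) - ((\<partial>\<^sub>t v - X v) / v) g\<close> calls for.\<close>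
  define \<phi> where "\<phi> p = - Dv (chart_at A p) p (1, - X p (chart_at A p)) / (2 * v t p)" for p
  have \<phi>: "\<phi> p = - Dv c p (1, - X p c) / (2 * v t p)" if c: "c \<in> charts_at A p" for c p
    unfolding \<phi>_def
    using material_derivative_chart_independent[OF assms(1) t bot chart_at_in[OF assms(1)] c X_tangent
        Dv[OF chart_at_in[OF assms(1)]] Dv[OF c]] by simp
  have soliton_in_chart: "1 / 2 * lie_derivative_in_chart A c X (g t) (chart_map c p) u w
      = 1 / 2 * tensor_in_chart A c (q (g t)) (chart_map c p) u w
        + \<phi> p * tensor_in_chart A c (g t) (chart_map c p) u w" if c: "c \<in> charts_at A p" for c p u w
  proof -
    have pos: "v t p > 0" using v t by blast
    have "lie_derivative_in_chart A c X (g t) (chart_map c p) u w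
      = tensor_in_chart A c (q (g t)) (chart_map c p) u w
        - Dv c p (1, - X p c) / v t p * tensor_in_chart A c (g t) (chart_map c p) u w"
      unfolding X_def
    proof (rule lie_derivative_of_conformal_pullback_family[OF fam g_sym[OF assms(4)] _ _ _ c Dv[OF c]])
      show "((\<lambda>s. g s p a b) has_real_derivative q (g t) p a b) (at t within I)"
        if "a \<in> tangent_space A p" "b \<in> tangent_space A p" for a b
        using assms(7) t that by (simp add: solves_flow_def)
    qed (use pos g in auto)
    then show ?thesis using pos by (simp add: \<phi>[OF c] field_simps)
  qed
  have "C_vector_field A (r + 1) X"
    using X_tangent X_Ck by (simp add: C_vector_field_def C_on_def)
  moreover have "C_function A r \<phi>"
    unfolding C_function_def C_on_def
  proof (intro ballI allI impI)
    \<comment> \<open>The formula defining \<open>\<phi>\<close> shows no continuity, as \<open>v\<close> is merely differentiable. But evaluated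
      on a constant coordinate vector \<open>u \<noteq> 0\<close>, the soliton equation can be solved for \<open>\<phi>\<close>, because
      \<open>g u u > 0\<close>, and everything else in it is of class \<open>C\<^sup>k\<close>.\<close>
    fix c k assume c: "c \<in> A" and k: "enat k \<le> r"
    obtain u :: 'e where u: "u \<noteq> 0" using nonzero_Basis SOME_Basis by blast
    let ?U = "chart_cod c"
    let ?L = "\<lambda>x. lie_derivative_in_chart A c X (g t) x u u"
    let ?Q = "\<lambda>x. tensor_in_chart A c (q (g t)) x u u" and ?g = "\<lambda>x. tensor_in_chart A c (g t) x u u"
    have "enat (Suc k) \<le> r + 1" using k by (cases r) (auto simp: one_enat_def)
    then have L: "Ck_on k ?U ?L"
      using Ck_on_lie_derivative_in_chart[OF assms(1) c g_sym[OF t] X_Ck] c by blast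
    have g_nz: "?g x \<noteq> 0" if "x \<in> ?U" for x
      using tensor_in_chart_pos[OF assms(1) metric[OF t] c that u] by simp
    have "Ck_on k ?U (\<lambda>x. 1 / 2 * (?L x - ?Q x) * inverse (?g x))"
      by (intro Ck_on_mult Ck_on_const Ck_on_diff Ck_on_inverse L g_nz
          symmetric_tensor_Ck_on[OF q_sym c] symmetric_tensor_Ck_on[OF g_sym[OF t] c])
    moreover have \<phi>_eq: "(\<phi> \<circ> chart_inv c) x = 1 / 2 * (?L x - ?Q x) * inverse (?g x)" if x: "x \<in> ?U" for x
      using soliton_in_chart[OF chart_inv_charts_at[OF assms(1) c x], of u u] g_nz[OF x]
        chart_map_inv[OF assms(1) c x] by (simp add: field_simps)
    ultimately show "Ck_on k ?U (\<phi> \<circ> chart_inv c)" by (simp only: Ck_on_cong[OF \<phi>_eq])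
  qed
  moreover have "1 / 2 * lie_derivative A X (g t) p a b = 1 / 2 * q (g t) p a b + \<phi> p * g t p a b"
    if "a \<in> tangent_space A p" "b \<in> tangent_space A p" for p a b
    using soliton_in_chart[OF chart_at_in[OF assms(1)]]
      tensor_eq_tensor_in_chart[OF assms(1) chart_at_in[OF assms(1)] that]
    by (simp add: lie_derivative_eq_in_chart[OF assms(1)])
  ultimately show "extended_soliton A r (q (g t)) (g t)"
    unfolding extended_soliton_def by blast
qed

end
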